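(* Let $d$ be a positive integer and let $(a_n)_{n\ge1}$ be a sequence in $\mathbb{R}^d$ with $\|a_n\|\to0$ which has $d$ linearly independent Lévy vectors. Then for all $L\in\mathbb{R}^d$, $$\dim\left\{\varepsilon=(\varepsilon_n)_{n\ge1} \in \Omega:\ \sum_{n=1}^\infty \varepsilon_n a_n = L \right\}=1.$$
   Context: $\Omega=\{-1,1\}^{\mathbb{N}}$ (with $\mathbb{N}=\{1,2,\dots\}$) is the set of infinite sign sequences, equipped with the ultrametric $\rho(\varepsilon,\omega)=2^{-\min\{n:\ \varepsilon_n\neq\omega_n\}}$ for $\varepsilon\ne\omega$, and $\rho(\varepsilon,\varepsilon)=0$. $\dim$ denotes Hausdorff dimension of subsets of $(\Omega,\rho)$. The condition $\sum_{n=1}^\infty \varepsilon_n a_n = L$ means that the partial sums converge to $L$. $\|\cdot\|$ is the Euclidean norm on $\mathbb{R}^d$, $\mathbb{S}^{d-1}$ is the unit sphere of $\mathbb{R}^d$, and $B(u,r)$ is the open ball of center $u$ and radius $r$. A vector $u\in\mathbb{S}^{d-1}$ is a Lévy vector of a sequence $(a_n)$ in $\mathbb{R}^d$ tending to $0$ if for every $\gamma>0$, $$\sum_{n=1}^\infty \|a_n\|\,\chi\!\left(\frac{a_n}{\|a_n\|}\in B(u,\gamma)\right)=\infty,$$ where $\chi(E)=1$ if the condition $E$ holds and $\chi(E)=0$ otherwise (terms with $a_n=0$ contribute $0$). *)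

theory Defs
  imports "HOL-Analysis.Analysis"
begin

section \<open>Hausdorff measure and dimension\<close>

text \<open>
  The case distinction makes \<^term>\<open>\<lambda>U. hausdorff_gauge s U\<close> the usual \<open>diam(U)\<^sup>s\<close> also in the boundary
  cases: the empty set contributes \<open>0\<close>, and \<open>0\<^sup>0 = 1\<close> for nonempty sets (whereas \<open>0 powr 0 = 0\<close>).
\<close>
definition hausdorff_gauge :: "real \<Rightarrow> 'a::metric_space set \<Rightarrow> ennreal" where
  "hausdorff_gauge s U =
     (if U = {} then 0 else if s = 0 then 1 else ennreal (diameter U powr s))"

text \<open>
  Boundedness is required because \<^const>\<open>diameter\<close> is only meaningful for bounded sets.
  Finite covers are included, since covering sets may be empty.
\<close>
definition hausdorff_premeasure :: "real \<Rightarrow> real \<Rightarrow> 'a::metric_space set \<Rightarrow> ennreal" where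
  "hausdorff_premeasure \<delta> s A =
     (INF U \<in> {U :: nat \<Rightarrow> 'a set. A \<subseteq> (\<Union>i. U i) \<and> (\<forall>i. bounded (U i) \<and> diameter (U i) \<le> \<delta>)}.
        \<Sum>i. hausdorff_gauge s (U i))"

definition hausdorff_measure :: "real \<Rightarrow> 'a::metric_space set \<Rightarrow> ennreal" where
  "hausdorff_measure s A = (SUP \<delta> \<in> {0<..}. hausdorff_premeasure \<delta> s A)"

definition hausdorff_dim :: "'a::metric_space set \<Rightarrow> ennreal" where
  "hausdorff_dim A = (INF s \<in> {s. 0 \<le> s \<and> hausdorff_measure s A = 0}. ennreal s)"

section \<open>Sign sequences\<close>

text \<open>Sequences are indexed from \<open>1\<close>; the value at index \<open>0\<close> is fixed to \<^const>\<open>undefined\<close>.\<close>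

typedef sign_seq = "{1..} \<rightarrow>\<^sub>E {- 1, 1} :: (nat \<Rightarrow> real) set"
  morphisms sign_at Abs_sign_seq
  by (rule exI[of _ "\<lambda>n\<in>{1..}. 1"]) auto

lemma sign_at_0: "sign_at \<epsilon> 0 = undefined"
  using sign_at[of \<epsilon>] by (auto simp: PiE_def extensional_def)

lemma sign_seq_neqE:
  assumes "\<epsilon> \<noteq> \<omega>"
  obtains n where "n \<ge> 1" "sign_at \<epsilon> n \<noteq> sign_at \<omega> n"
proof -
  obtain n where n: "sign_at \<epsilon> n \<noteq> sign_at \<omega> n"
    using assms by (metis ext sign_at_inject)
  then have "n \<ge> 1" by (cases n) (auto simp: sign_at_0)
  with n that show thesis by blast
qed

definition first_diff :: "sign_seq \<Rightarrow> sign_seq \<Rightarrow> nat" where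
  "first_diff \<epsilon> \<omega> = (LEAST n. n \<ge> 1 \<and> sign_at \<epsilon> n \<noteq> sign_at \<omega> n)"

instantiation sign_seq :: metric_space
begin

definition dist_sign_seq :: "sign_seq \<Rightarrow> sign_seq \<Rightarrow> real" where
  "dist_sign_seq \<epsilon> \<omega> = (if \<epsilon> = \<omega> then 0 else 2 powr - real (first_diff \<epsilon> \<omega>))"

definition uniformity_sign_seq :: "(sign_seq \<times> sign_seq) filter" where
  "uniformity_sign_seq = (INF e\<in>{0<..}. principal {(x, y). dist x y < e})"

definition open_sign_seq :: "sign_seq set \<Rightarrow> bool" where
  "open_sign_seq U = (\<forall>x\<in>U. \<forall>\<^sub>F (x', y) in uniformity. x' = x \<longrightarrow> y \<in> U)"

instance
proof
  fix x y z :: sign_seq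
  show "dist x y = 0 \<longleftrightarrow> x = y"
    by (simp add: dist_sign_seq_def)
  have sym: "first_diff a b = first_diff b a" for a b
    unfolding first_diff_def by metis
  show "dist x y \<le> dist x z + dist y z"
  proof (cases "x = y \<or> x = z \<or> y = z")
    case True
    then show ?thesis by (auto simp: dist_sign_seq_def sym)
  next
    case False
    then have ne: "x \<noteq> y" "x \<noteq> z" "y \<noteq> z" by auto
    define n where "n = first_diff x y"
    obtain k where k: "k \<ge> 1 \<and> sign_at x k \<noteq> sign_at y k"
      using ne(1) by (blast elim: sign_seq_neqE)
    have n: "n \<ge> 1 \<and> sign_at x n \<noteq> sign_at y n"
      unfolding n_def first_diff_def by (rule LeastI[of _ k]) (rule k)
    then consider "sign_at x n \<noteq> sign_at z n" | "sign_at y n \<noteq> sign_at z n" by metis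
    then have "first_diff x z \<le> n \<or> first_diff y z \<le> n"
      using n unfolding first_diff_def by cases (blast intro: Least_le)+
    then have "2 powr - real n \<le> 2 powr - real (first_diff x z) \<or>
        2 powr - real n \<le> 2 powr - real (first_diff y z)"
      by auto
    then have "2 powr - real n \<le> 2 powr - real (first_diff x z) + 2 powr - real (first_diff y z)"
      using powr_ge_zero[of 2 "- real (first_diff x z)"] powr_ge_zero[of 2 "- real (first_diff y z)"]
      by linarith
    then show ?thesis
      using ne by (simp add: dist_sign_seq_def n_def)
  qed
qed (rule uniformity_sign_seq_def open_sign_seq_def)+

end

section \<open>Levy vectors\<close>

text \<open>
  Sequences are again indexed from \<open>1\<close>, hence the shift by \<^const>\<open>Suc\<close>; \<open>a 0\<close> plays no role.
  Terms with \<open>a n = 0\<close> contribute \<open>0\<close>.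
\<close>
definition levy_vector :: "(nat \<Rightarrow> 'a::real_normed_vector) \<Rightarrow> 'a \<Rightarrow> bool" where
  "levy_vector a u \<longleftrightarrow> norm u = 1 \<and>
     (\<forall>\<gamma>>0. (\<Sum>n. ennreal (norm (a (Suc n)) *
         of_bool (a (Suc n) /\<^sub>R norm (a (Suc n)) \<in> ball u \<gamma>))) = \<infinity>)"

end

theory Submission
  imports Defs "HOL-Probability.Probability"
begin

text \<open>
  Fix a large block length \<open>m\<close>. For each of the \<open>d\<close> Levy vectors there is a residue class modulo \<open>m\<close>
  along which it is still a Levy vector. Outside these classes choose the signs freely and compute the
  resulting sum over each block. By the argument of Barany and Grinberg, there are signs making any
  null sequence in \<open>\<real>\<^sup>d\<close> summable; applied to the block sums, this gives one global sign per block after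
  which the freely signed part converges, while the free choice can still be read off up to these signs.
  The remaining terms contain, for each Levy vector \<open>u\<close>, a subsequence of infinite total norm whose
  deviation from the direction \<open>u\<close> is absolutely summable, so a greedy choice of their signs steers the
  sum to \<open>L\<close>. Thus at most \<open>d + 1\<close> signs out of \<open>m\<close> are lost, and the mass distribution principle bounds
  the dimension from below by \<open>1 - (d + 1) / m\<close>.
\<close>

section \<open>Signs making a null sequence summable\<close>

lemma linear_dependence_family:
  fixes y :: "'i \<Rightarrow> 'a::euclidean_space"
  assumes "finite F" "card F > DIM('a)"
  obtains l where "\<exists>i\<in>F. l i \<noteq> 0" "(\<Sum>i\<in>F. l i *\<^sub>R y i) = 0"
proof (cases "inj_on y F")
  case True
  then have "dependent (y ` F)"
    using assms by (intro dependent_biggerset) (auto simp: card_image)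
  then obtain u where u: "\<exists>v\<in>y ` F. u v \<noteq> 0" "(\<Sum>v\<in>y ` F. u v *\<^sub>R v) = 0"
    using assms(1) by (auto simp: dependent_finite)
  show thesis
    using u by (intro that[of "u \<circ> y"]) (auto simp: sum.reindex[OF True])
next
  \<comment> \<open>\<open>dependent\<close> speaks of sets and does not see repetitions; two equal
    members give a relation with coefficients 1 and -1.\<close>
  case False
  then obtain i j where ij: "i \<in> F" "j \<in> F" "i \<noteq> j" "y i = y j"
    by (auto simp: inj_on_def)
  have "(\<Sum>k\<in>F. ((if k = i then 1 else 0) - (if k = j then 1 else 0)) *\<^sub>R y k) = 0"
    using ij assms(1)
    by (simp add: scaleR_diff_left sum_subtractf if_distrib[of "\<lambda>r. r *\<^sub>R _"] cong: if_cong)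
  then show thesis
    using ij by (intro that[of "\<lambda>k. (if k = i then 1 else 0) - (if k = j then 1 else 0)"]) auto
qed

lemma round_one_coordinate:
  fixes x l :: "'i \<Rightarrow> real"
  assumes F: "finite F" "\<And>i. i \<in> F \<Longrightarrow> \<bar>x i\<bar> < 1" and l: "\<exists>i\<in>F. l i \<noteq> 0"
  obtains t where "\<And>i. i \<in> F \<Longrightarrow> \<bar>x i + t * l i\<bar> \<le> 1" "\<exists>i\<in>F. \<bar>x i + t * l i\<bar> = 1"
proof -
  \<comment> \<open>\<open>T i\<close> is the time at which coordinate \<open>i\<close>, moving with
    velocity \<open>l i\<close>, meets the face of the cube that it heads for. The earliest of these
    times keeps every coordinate inside and puts one on the boundary.\<close>
  define T where "T i = (1 - x i * sgn (l i)) / \<bar>l i\<bar>" for i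
  define I where "I = {i\<in>F. l i \<noteq> 0}"
  define t where "t = Min (T ` I)"
  have I: "finite I" "I \<noteq> {}" using F l by (auto simp: I_def)
  have T_pos: "T i > 0" if "i \<in> I" for i
    using that F(2)[of i] by (auto simp: T_def I_def sgn_real_def abs_less_iff)
  have "t \<in> T ` I" using I by (simp add: t_def)
  then obtain i0 where i0: "i0 \<in> I" "t = T i0" by auto
  then have "t > 0" using T_pos by simp
  show thesis
  proof (rule that)
    show "\<bar>x i + t * l i\<bar> \<le> 1" if i: "i \<in> F" for i
    proof (cases "l i = 0")
      case True
      then show ?thesis using F(2)[OF i] by simp
    next
      case False
      then have "t \<le> T i" using i I by (simp add: t_def I_def)
      then have "t * \<bar>l i\<bar> \<le> 1 - x i * sgn (l i)"
        using False by (simp add: T_def field_simps)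
      moreover have "t * \<bar>l i\<bar> > 0" using \<open>t > 0\<close> False by simp
      ultimately show ?thesis
        using F(2)[OF i] False
        by (cases "l i > 0") (auto simp: abs_le_iff abs_less_iff sgn_real_def)
    qed
    have "\<bar>x i0 + t * l i0\<bar> = 1"
      using i0 by (cases "l i0 > 0") (auto simp: T_def I_def sgn_real_def field_simps)
    then show "\<exists>i\<in>F. \<bar>x i + t * l i\<bar> = 1"
      using i0 by (auto simp: I_def)
  qed
qed

text \<open>Fractional signs \<^term>\<open>x\<close> with sum zero, of which at most \<open>DIM('a)\<close> are not yet rounded.\<close>

definition floating :: "(nat \<Rightarrow> 'a::euclidean_space) \<Rightarrow> nat \<Rightarrow> (nat \<Rightarrow> real) \<Rightarrow> bool" where
  "floating y k x \<longleftrightarrow> (\<forall>i. \<bar>x i\<bar> \<le> 1) \<and> (\<Sum>i<k. x i *\<^sub>R y i) = 0 \<and>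
     card {i. i < k \<and> \<bar>x i\<bar> < 1} \<le> DIM('a)"

text \<open>The new vector enters with coefficient 0, which adds one unrounded index. If there are
  now more than \<open>DIM('a)\<close> of them, their vectors satisfy a linear relation; moving
  along it keeps the sum at zero until some coefficient reaches -1 or 1.\<close>

lemma floating_step:
  fixes y :: "nat \<Rightarrow> 'a::euclidean_space"
  assumes x: "floating y k x"
  shows "\<exists>x'. floating y (Suc k) x' \<and> (\<forall>i<k. \<bar>x i\<bar> = 1 \<longrightarrow> x' i = x i)"
proof -
  define z where "z = x(k := 0)"
  define F where "F = {i. i < Suc k \<and> \<bar>z i\<bar> < 1}"
  have F: "finite F" "\<And>i. i \<in> F \<Longrightarrow> \<bar>z i\<bar> < 1" by (auto simp: F_def)
  have z: "\<bar>z i\<bar> \<le> 1" for i using x by (auto simp: floating_def z_def)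
  have z_sum: "(\<Sum>i<Suc k. z i *\<^sub>R y i) = 0"
    using x by (simp add: floating_def z_def)
  have "F = insert k {i. i < k \<and> \<bar>x i\<bar> < 1}"
    by (auto simp: F_def z_def)
  then have cardF: "card F \<le> Suc DIM('a)"
    using x by (simp add: floating_def)
  show ?thesis
  proof (cases "card F \<le> DIM('a)")
    case True
    then have "floating y (Suc k) z"
      using z z_sum by (simp add: floating_def F_def)
    then show ?thesis by (intro exI[of _ z]) (auto simp: z_def)
  next
    case False
    then have "DIM('a) < card F" by simp
    with F(1) obtain l where l: "\<exists>i\<in>F. l i \<noteq> 0" "(\<Sum>i\<in>F. l i *\<^sub>R y i) = 0"
      by (rule linear_dependence_family)
    obtain t where t: "\<And>i. i \<in> F \<Longrightarrow> \<bar>z i + t * l i\<bar> \<le> 1" "\<exists>i\<in>F. \<bar>z i + t * l i\<bar> = 1"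
      using round_one_coordinate[of F z l] F l(1) by blast
    define x' where "x' i = (if i \<in> F then z i + t * l i else z i)" for i
    have F_sub: "F \<subseteq> {..<Suc k}" by (auto simp: F_def)
    have x'_eq: "x' i *\<^sub>R y i = z i *\<^sub>R y i + (if i \<in> F then t *\<^sub>R (l i *\<^sub>R y i) else 0)" for i
      by (simp add: x'_def scaleR_add_left)
    have "(\<Sum>i<Suc k. if i \<in> F then t *\<^sub>R (l i *\<^sub>R y i) else 0) = (\<Sum>i\<in>F. t *\<^sub>R (l i *\<^sub>R y i))"
      using F_sub by (intro sum.mono_neutral_cong_right) auto
    also have "\<dots> = t *\<^sub>R (\<Sum>i\<in>F. l i *\<^sub>R y i)"
      by (rule scaleR_sum_right[symmetric])
    finally have "(\<Sum>i<Suc k. if i \<in> F then t *\<^sub>R (l i *\<^sub>R y i) else 0) = 0"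
      by (simp only: l(2) scaleR_zero_right)
    then have sum0: "(\<Sum>i<Suc k. x' i *\<^sub>R y i) = 0"
      unfolding x'_eq sum.distrib z_sum by simp
    obtain i0 where i0: "i0 \<in> F" "\<bar>z i0 + t * l i0\<bar> = 1" using t(2) by auto
    have "{i. i < Suc k \<and> \<bar>x' i\<bar> < 1} \<subseteq> F - {i0}"
      using i0 by (auto simp: x'_def F_def split: if_splits)
    then have "card {i. i < Suc k \<and> \<bar>x' i\<bar> < 1} \<le> card (F - {i0})"
      using F(1) by (intro card_mono) auto
    also have "\<dots> \<le> DIM('a)" using cardF i0 F(1) by simp
    finally have "floating y (Suc k) x'"
      using sum0 t(1) z by (auto simp: floating_def x'_def)
    moreover have "\<forall>i<k. \<bar>x i\<bar> = 1 \<longrightarrow> x' i = x i"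
      by (auto simp: x'_def F_def z_def)
    ultimately show ?thesis by blast
  qed
qed

text \<open>At each time \<open>k\<close> the fractional signs \<open>X k\<close> have sum zero, and
  a value that has reached -1 or 1 never changes again. So the final signs differ from
  \<open>X k\<close> at no more than \<open>DIM('a)\<close> indices below \<open>k\<close>, and
  there by at most 2.\<close>

lemma signs_prefix_bound:
  fixes y :: "nat \<Rightarrow> 'a::euclidean_space" and c :: real
  assumes y: "\<And>i. i < n \<Longrightarrow> norm (y i) \<le> c" and "c \<ge> 0"
  obtains \<sigma> :: "nat \<Rightarrow> real"
  where "\<And>i. \<sigma> i \<in> {-1, 1}" "\<And>k. k \<le> n \<Longrightarrow> norm (\<Sum>i<k. \<sigma> i *\<^sub>R y i) \<le> 2 * DIM('a) * c"
proof -
  have "floating y 0 (\<lambda>_. 0)" by (simp add: floating_def)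
  then have "\<exists>X. \<forall>k. floating y k (X k) \<and> (\<forall>i<k. \<bar>X k i\<bar> = 1 \<longrightarrow> X (Suc k) i = X k i)"
    by (intro dependent_nat_choice floating_step) blast+
  then obtain X where "\<forall>k. floating y k (X k) \<and> (\<forall>i<k. \<bar>X k i\<bar> = 1 \<longrightarrow> X (Suc k) i = X k i)"
    by blast
  then have X: "floating y k (X k)" and X_Suc: "\<And>i. i < k \<Longrightarrow> \<bar>X k i\<bar> = 1 \<Longrightarrow> X (Suc k) i = X k i" for k
    by blast+
  have frozen: "X (k + j) i = X k i" if "i < k" "\<bar>X k i\<bar> = 1" for k j i
    using that by (induction j) (auto simp: X_Suc)
  \<comment> \<open>An index still fractional at time \<open>n\<close> gets the default sign 1. By
    \<open>frozen\<close> it was fractional at each earlier time that included it, so it lies in the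
    exceptional set \<open>F\<close> below.\<close>
  define \<sigma> where "\<sigma> i = (if \<bar>X n i\<bar> = 1 then X n i else 1)" for i
  have \<sigma>: "\<sigma> i \<in> {-1, 1}" for i by (auto simp: \<sigma>_def abs_if split: if_splits)
  have "norm (\<Sum>i<k. \<sigma> i *\<^sub>R y i) \<le> 2 * DIM('a) * c" if k: "k \<le> n" for k
  proof -
    define F where "F = {i. i < k \<and> \<bar>X k i\<bar> < 1}"
    have cF: "card F \<le> DIM('a)" and X0: "(\<Sum>i<k. X k i *\<^sub>R y i) = 0" and X1: "\<And>i. \<bar>X k i\<bar> \<le> 1"
      using X[of k] by (auto simp: floating_def F_def)
    have "(\<Sum>i<k. \<sigma> i *\<^sub>R y i) = (\<Sum>i<k. (\<sigma> i - X k i) *\<^sub>R y i)"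
      by (simp add: scaleR_diff_left sum_subtractf X0)
    also have "\<dots> = (\<Sum>i\<in>F. (\<sigma> i - X k i) *\<^sub>R y i)"
    proof (rule sum.mono_neutral_right)
      show "\<forall>i\<in>{..<k} - F. (\<sigma> i - X k i) *\<^sub>R y i = 0"
      proof
        fix i assume "i \<in> {..<k} - F"
        then have "i < k" "\<bar>X k i\<bar> = 1" using X1[of i] by (auto simp: F_def)
        then have "X n i = X k i" using frozen[of i k "n - k"] k by simp
        then show "(\<sigma> i - X k i) *\<^sub>R y i = 0" using \<open>\<bar>X k i\<bar> = 1\<close> by (simp add: \<sigma>_def)
      qed
    qed (auto simp: F_def)
    also have "norm \<dots> \<le> (\<Sum>i\<in>F. 2 * c)"
    proof (rule sum_norm_le)
      fix i assume "i \<in> F"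
      then have "norm (y i) \<le> c" using y k by (auto simp: F_def)
      moreover have "\<bar>\<sigma> i - X k i\<bar> \<le> 2" using \<sigma>[of i] X1[of i] by auto
      ultimately show "norm ((\<sigma> i - X k i) *\<^sub>R y i) \<le> 2 * c"
        by (simp add: mult_mono)
    qed
    also have "\<dots> = real (card F) * (2 * c)" by simp
    also have "\<dots> \<le> real DIM('a) * (2 * c)"
      using cF \<open>c \<ge> 0\<close> by (intro mult_right_mono) auto
    finally show ?thesis by (simp add: mult_ac)
  qed
  with \<sigma> show thesis by (rule that)
qed

text \<open>The sequence is cut into chunks on which the terms are bounded geometrically, and each
  chunk gets its own signs with bounded prefixes. The bounds \<open>D j\<close> are summable, so the
  sums at chunk ends converge, and within chunk \<open>j\<close> the partial sums stray by at most
  \<open>D j\<close>.\<close>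

lemma signs_summable:
  fixes y :: "nat \<Rightarrow> 'a::euclidean_space"
  assumes y: "y \<longlonglongrightarrow> 0"
  obtains \<sigma> :: "nat \<Rightarrow> real" where "\<And>i. \<sigma> i \<in> {-1, 1}" "summable (\<lambda>i. \<sigma> i *\<^sub>R y i)"
proof -
  define C where "C = 2 * real DIM('a)"
  have "\<exists>N. \<forall>k\<ge>N. norm (y k) \<le> (1/2) ^ j" for j
    using y[THEN tendsto_norm] order_tendstoD(2)[of "\<lambda>k. norm (y k)" 0 sequentially "(1/2)^j"]
    by (auto simp: eventually_sequentially intro: less_imp_le)
  then obtain N where N: "\<And>j k. k \<ge> N j \<Longrightarrow> norm (y k) \<le> (1/2) ^ j" by metis
  \<comment> \<open>For \<open>j > 0\<close> the last summand is \<open>Suc (N j)\<close>, so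
    \<open>K j\<close> lies beyond \<open>N j\<close>; the successor makes \<open>K\<close> strictly
    increasing. Chunk 0 starts at index 0, where only the bound \<open>M\<close> is available, hence
    the factor \<open>M + 1\<close> below.\<close>
  define K where "K j = (\<Sum>i<j. Suc (N (Suc i)))" for j
  have "strict_mono K" by (auto simp: strict_mono_Suc_iff K_def)
  have K0: "K 0 = 0" by (simp add: K_def)
  have "Bseq y" using y by (simp add: convergentI convergent_imp_Bseq)
  then obtain M where M: "M > 0" "\<And>i. norm (y i) \<le> M" by (auto simp: Bseq_def)
  have bound: "norm (y k) \<le> (M + 1) * (1/2) ^ j" if "K j \<le> k" for j k
  proof (cases j)
    case 0
    then show ?thesis using M(2)[of k] by simp
  next
    case (Suc i)
    then have "N j \<le> k" using that by (simp add: K_def)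
    then have "norm (y k) \<le> 1 * (1/2) ^ j" using N by simp
    also have "\<dots> \<le> (M + 1) * (1/2) ^ j" using M by (intro mult_right_mono) auto
    finally show ?thesis .
  qed
  define D where "D j = C * ((M + 1) * (1/2) ^ j)" for j :: nat
  have "\<exists>\<sigma> :: nat \<Rightarrow> real. (\<forall>i. \<sigma> i \<in> {-1, 1}) \<and>
      (\<forall>k\<le>K (Suc j) - K j. norm (\<Sum>i<k. \<sigma> i *\<^sub>R y (K j + i)) \<le> D j)" for j
  proof -
    have "norm (y (K j + i)) \<le> (M + 1) * (1/2) ^ j" for i using bound by simp
    then show ?thesis
      using signs_prefix_bound[of "K (Suc j) - K j" "\<lambda>i. y (K j + i)" "(M + 1) * (1/2) ^ j" ?thesis] M(1)
      unfolding C_def D_def by auto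
  qed
  then obtain \<tau> :: "nat \<Rightarrow> nat \<Rightarrow> real" where \<tau>: "\<And>j i. \<tau> j i \<in> {-1, 1}"
    "\<And>j k. k \<le> K (Suc j) - K j \<Longrightarrow> norm (\<Sum>i<k. \<tau> j i *\<^sub>R y (K j + i)) \<le> D j"
    by metis
  have "\<exists>j. K j \<le> k \<and> k < K (Suc j)" for k
  proof (induction k)
    case 0
    then show ?case using \<open>strict_mono K\<close> K0 by (intro exI[of _ 0]) (metis le_refl strict_mono_Suc_iff)
  next
    case (Suc k)
    then obtain j where j: "K j \<le> k" "k < K (Suc j)" by blast
    show ?case
    proof (cases "Suc k < K (Suc j)")
      case True
      then show ?thesis using j by (intro exI[of _ j]) auto
    next
      case False
      moreover have "K (Suc j) < K (Suc (Suc j))" using \<open>strict_mono K\<close> by (simp add: strict_mono_Suc_iff)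
      ultimately show ?thesis using j by (intro exI[of _ "Suc j"]) auto
    qed
  qed
  then obtain J where J: "\<And>k. K (J k) \<le> k" "\<And>k. k < K (Suc (J k))" by metis
  have J_eq: "J k = j" if "K j \<le> k" "k < K (Suc j)" for j k
  proof -
    have "K (J k) < K (Suc j)" "K j < K (Suc (J k))" using J[of k] that by linarith+
    then show ?thesis using \<open>strict_mono K\<close> by (simp add: strict_mono_less)
  qed
  have "filterlim J at_top sequentially"
    unfolding filterlim_at_top eventually_sequentially
  proof (intro allI exI impI)
    fix j k assume "K j \<le> k"
    then have "K j < K (Suc (J k))" using J[of k] by linarith
    then show "j \<le> J k" using \<open>strict_mono K\<close> by (simp add: strict_mono_less)
  qed
  define \<sigma> where "\<sigma> k = \<tau> (J k) (k - K (J k))" for k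
  define S where "S k = (\<Sum>i<k. \<sigma> i *\<^sub>R y i)" for k
  have S_chunk: "S (K j + k) = S (K j) + (\<Sum>i<k. \<tau> j i *\<^sub>R y (K j + i))"
    if "k \<le> K (Suc j) - K j" for j k
    using that
  proof (induction k)
    case (Suc k)
    then have "J (K j + k) = j" by (intro J_eq) auto
    then have "\<sigma> (K j + k) = \<tau> j k" by (simp add: \<sigma>_def)
    then show ?case using Suc by (simp add: S_def add_ac)
  qed simp
  have D_sum: "summable D" unfolding D_def by (intro summable_mult summable_geometric) auto
  have "norm (S (K (Suc j)) - S (K j)) \<le> D j" for j
  proof -
    have "K j \<le> K (Suc j)" using \<open>strict_mono K\<close> by (simp add: strict_mono_less_eq)
    then show ?thesis
      using S_chunk[of "K (Suc j) - K j" j] \<tau>(2)[of "K (Suc j) - K j" j] by simp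
  qed
  then have "summable (\<lambda>j. S (K (Suc j)) - S (K j))"
    by (intro summable_comparison_test'[OF D_sum, of 0])
  then have "convergent (\<lambda>j. S (K j) - S (K 0))"
    unfolding summable_iff_convergent sum_lessThan_telescope[of "\<lambda>j. S (K j)"] .
  then have "convergent (\<lambda>j. S (K j))" by (simp add: K0) (simp add: S_def)
  then obtain s where s: "(\<lambda>j. S (K j)) \<longlonglongrightarrow> s" by (auto simp: convergent_def)
  have "(\<lambda>k. S k - S (K (J k))) \<longlonglongrightarrow> 0"
  proof (rule Lim_null_comparison)
    show "(\<lambda>k. D (J k)) \<longlonglongrightarrow> 0"
      using summable_LIMSEQ_zero[OF D_sum] \<open>filterlim J at_top sequentially\<close> by (rule filterlim_compose)
    have "norm (S k - S (K (J k))) \<le> D (J k)" for k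
      using S_chunk[of "k - K (J k)" "J k"] \<tau>(2)[of "k - K (J k)" "J k"] J[of k] by simp
    then show "\<forall>\<^sub>F k in sequentially. norm (S k - S (K (J k))) \<le> D (J k)" by simp
  qed
  moreover have "(\<lambda>k. S (K (J k))) \<longlonglongrightarrow> s"
    using s \<open>filterlim J at_top sequentially\<close> by (rule filterlim_compose)
  ultimately have "(\<lambda>k. (S k - S (K (J k))) + S (K (J k))) \<longlonglongrightarrow> 0 + s" by (rule tendsto_add)
  then have "S \<longlonglongrightarrow> s" by simp
  then have "summable (\<lambda>i. \<sigma> i *\<^sub>R y i)" by (auto simp: summable_def sums_def S_def[abs_def])
  moreover have "\<sigma> i \<in> {-1, 1}" for i using \<tau>(1) by (simp add: \<sigma>_def)
  ultimately show thesis by (intro that)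
qed

section \<open>Steering along Levy vectors\<close>

text \<open>As long as \<open>w n > t n\<close>, a step lowers \<open>w\<close> by
  \<open>t n\<close> up to the error \<open>\<delta> n\<close>; since \<open>t\<close> has infinite
  sum and \<open>\<delta>\<close> a finite one, \<open>w\<close> must at some late time be at most
  \<open>t\<close>, hence small. From then on overshooting is harmless because the steps are
  small.\<close>

lemma greedy_tendsto_0:
  fixes w t \<delta> :: "nat \<Rightarrow> real"
  assumes w: "\<And>n. w n \<ge> 0" and step: "\<And>n. w (Suc n) \<le> \<bar>w n - t n\<bar> + \<delta> n"
    and t: "\<And>n. t n \<ge> 0" "t \<longlonglongrightarrow> 0" "\<not> summable t"
    and \<delta>: "\<And>n. \<delta> n \<ge> 0" "summable \<delta>"
  shows "w \<longlonglongrightarrow> 0"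
proof (rule LIMSEQ_I)
  fix r :: real assume "r > 0"
  define e where "e = r / 3"
  have e: "e > 0" using \<open>r > 0\<close> by (simp add: e_def)
  obtain N1 where N1: "\<And>n. n \<ge> N1 \<Longrightarrow> t n \<le> e"
    using order_tendstoD(2)[OF t(2) e] by (auto simp: eventually_sequentially intro: less_imp_le)
  obtain N2 where N2: "norm (\<Sum>i. \<delta> (i + N2)) < e" "N2 \<ge> N1"
  proof -
    obtain N where "\<And>n. n \<ge> N \<Longrightarrow> norm (\<Sum>i. \<delta> (i + n)) < e"
      using suminf_exist_split[OF e \<delta>(2)] by blast
    then show thesis by (intro that[of "max N N1"]) auto
  qed
  have \<delta>_sum: "(\<Sum>i\<in>{n0..<n}. \<delta> i) \<le> e" if "n0 \<ge> N2" for n0 n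
  proof -
    have "(\<Sum>i\<in>{n0..<n}. \<delta> i) \<le> (\<Sum>i\<in>{N2..<N2 + n}. \<delta> i)"
      using that \<delta>(1) by (intro sum_mono2) auto
    also have "\<dots> = (\<Sum>i<n. \<delta> (i + N2))"
      using sum.shift_bounds_nat_ivl[of \<delta> 0 N2 n] by (simp add: add.commute atLeast0LessThan)
    also have "\<dots> \<le> (\<Sum>i. \<delta> (i + N2))"
      using \<delta> by (intro sum_le_suminf) (auto simp: summable_iff_shift)
    also have "\<dots> \<le> e" using N2(1) by (simp add: abs_less_iff)
    finally show ?thesis .
  qed
  have "\<exists>n0\<ge>N2. w n0 \<le> t n0"
  proof (rule ccontr)
    assume "\<not> ?thesis"
    with not_le have gt: "w n > t n" if "n \<ge> N2" for n using that by blast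
    have desc: "w (N2 + n) \<le> w N2 - (\<Sum>i\<in>{N2..<N2 + n}. t i) + (\<Sum>i\<in>{N2..<N2 + n}. \<delta> i)" for n
    proof (induction n)
      case (Suc n)
      then show ?case using step[of "N2 + n"] gt[of "N2 + n"] by (simp add: abs_if)
    qed simp
    have "(\<Sum>i<n. t (i + N2)) \<le> w N2 + e" for n
    proof -
      have "(\<Sum>i<n. t (i + N2)) = (\<Sum>i\<in>{N2..<N2 + n}. t i)"
        using sum.shift_bounds_nat_ivl[of t 0 N2 n] by (simp add: add.commute atLeast0LessThan)
      also have "\<dots> \<le> w N2 + e" using desc[of n] w[of "N2 + n"] \<delta>_sum[of N2 "N2 + n"] by linarith
      finally show ?thesis .
    qed
    from this[of "Suc _"] have "summable (\<lambda>i. t (i + N2))"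
      unfolding lessThan_Suc_atMost using t(1) by (intro bounded_imp_summable)
    then show False using t(3) by (simp add: summable_iff_shift)
  qed
  then obtain n0 where n0: "n0 \<ge> N2" "w n0 \<le> t n0" by blast
  \<comment> \<open>As \<open>\<bar>w - t\<bar>\<close> is at most the maximum of \<open>w\<close>
    and \<open>t\<close>, and \<open>t\<close> is at most \<open>e\<close> from here on, a step can
    raise the bound only by \<open>\<delta>\<close>.\<close>
  have "w (n0 + n) \<le> e + (\<Sum>i\<in>{n0..<n0 + n}. \<delta> i)" for n
  proof (induction n)
    case 0
    then show ?case using n0 N2(2) N1[of n0] by simp
  next
    case (Suc n)
    have "t (n0 + n) \<le> e" using N1 N2(2) n0(1) by simp
    moreover have "(\<Sum>i\<in>{n0..<n0 + n}. \<delta> i) \<ge> 0" using \<delta>(1) by (intro sum_nonneg) auto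
    ultimately have "\<bar>w (n0 + n) - t (n0 + n)\<bar> \<le> e + (\<Sum>i\<in>{n0..<n0 + n}. \<delta> i)"
      using Suc w[of "n0 + n"] t(1)[of "n0 + n"] by (auto simp: abs_if)
    then show ?case using step[of "n0 + n"] by simp
  qed
  then have "w (n0 + n) \<le> 2 * e" for n using \<delta>_sum[of n0 "n0 + n"] n0(1) by (smt (verit))
  then have "w n \<le> 2 * e" if "n \<ge> n0" for n using that by (metis le_add_diff_inverse)
  moreover have "2 * e < r" using \<open>r > 0\<close> by (simp add: e_def)
  ultimately show "\<exists>no. \<forall>n\<ge>no. norm (w n - 0) < r"
    using w by (intro exI[of _ n0]) (auto simp: intro: le_less_trans)
qed

section \<open>Steering in coordinates with respect to a basis of directions\<close>

lemma dimension_basis_span_UNIV: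
  fixes B :: "'a::euclidean_space set"
  assumes "independent B" "card B = DIM('a)"
  shows "finite B" "span B = UNIV"
proof -
  show "finite B" using assms(1) independent_imp_finite by blast
  have "UNIV \<subseteq> span B"
    using assms by (intro card_ge_dim_independent) auto
  then show "span B = UNIV" by blast
qed

text \<open>For \<open>n\<close> in \<open>G v\<close> the term \<open>b n\<close> is a multiple of
  \<open>v\<close> up to a summable error, so its sign can be chosen to reduce the
  \<open>v\<close>-coordinate of the remainder while the other coordinates move only by the error.
  Each coordinate thus follows the greedy scheme of \<open>greedy_tendsto_0\<close>.\<close>

lemma steering:
  fixes b :: "nat \<Rightarrow> 'a::euclidean_space" and G :: "'a \<Rightarrow> nat set"
  assumes b: "b \<longlonglongrightarrow> 0"
    and B: "independent B" "card B = DIM('a)"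
    and disj: "\<And>u v. u \<in> B \<Longrightarrow> v \<in> B \<Longrightarrow> u \<noteq> v \<Longrightarrow> G u \<inter> G v = {}"
    and mass: "\<And>u. u \<in> B \<Longrightarrow> \<not> summable (\<lambda>n. if n \<in> G u then norm (b n) else 0)"
    and dev: "\<And>u. u \<in> B \<Longrightarrow> summable (\<lambda>n. if n \<in> G u then norm (b n - norm (b n) *\<^sub>R u) else 0)"
  obtains \<epsilon> :: "nat \<Rightarrow> real"
  where "\<And>n. \<epsilon> n \<in> {-1, 1}" "(\<lambda>n. if n \<in> (\<Union>u\<in>B. G u) then \<epsilon> n *\<^sub>R b n else 0) sums L"
proof -
  note span = dimension_basis_span_UNIV[OF B]
  define r where "r u x = representation B x u" for u x
  have lin: "linear (r u)" for u
    by (rule linearI)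
       (simp_all add: r_def real_vector.representation_add[OF B(1)]
          real_vector.representation_scale[OF B(1)] span(2))
  have r_basis: "r u v = (if u = v then 1 else 0)" if "v \<in> B" for u v
    using that B(1) by (auto simp: r_def real_vector.representation_basis)
  have "\<exists>K. \<forall>x. \<bar>r u x\<bar> \<le> norm x * K" for u
    using lin[of u] bounded_linear.bounded[of "r u"] by (simp add: linear_conv_bounded_linear)
  then obtain K0 where K0: "\<And>u x. \<bar>r u x\<bar> \<le> norm x * K0 u" by metis
  define K where "K = (\<Sum>u\<in>B. \<bar>K0 u\<bar>)"
  have K: "\<bar>r u x\<bar> \<le> K * norm x" if "u \<in> B" for u x
  proof -
    have "K0 u \<le> K"
      using span(1) that member_le_sum[of u B "\<lambda>u. \<bar>K0 u\<bar>"] by (auto simp: K_def)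
    then have "norm x * K0 u \<le> norm x * K" by (rule mult_left_mono) simp
    then show ?thesis using K0[of u x] by (simp add: mult.commute)
  qed
  have "K \<ge> 0" by (simp add: K_def sum_nonneg)
  \<comment> \<open>The direction that owns index \<open>n\<close>, unique by \<open>disj\<close>.
    Outside \<open>H\<close> it is unspecified, which affects only signs whose terms are absent from
    the sum.\<close>
  define ch where "ch n = (THE u. u \<in> B \<and> n \<in> G u)" for n
  have ch: "ch n = u" if "u \<in> B" "n \<in> G u" for n u
    unfolding ch_def using that disj by (intro the_equality) auto
  define sg :: "real \<Rightarrow> real" where "sg s = (if s \<ge> 0 then 1 else -1)" for s
  define H where "H = (\<Union>u\<in>B. G u)"
  \<comment> \<open>\<open>X n\<close> is what is still missing after \<open>n\<close> steps, namely
    \<open>L\<close> minus the partial sum; the sign pushes its coordinate in direction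
    \<open>ch n\<close> towards 0 or past it.\<close>
  define X where "X = rec_nat L (\<lambda>n x. if n \<in> H then x - sg (r (ch n) x) *\<^sub>R b n else x)"
  have X_0: "X 0 = L" by (simp add: X_def)
  have X_Suc: "X (Suc n) = (if n \<in> H then X n - sg (r (ch n) (X n)) *\<^sub>R b n else X n)" for n
    by (simp add: X_def)
  define \<epsilon> where "\<epsilon> n = sg (r (ch n) (X n))" for n
  have X_eq: "X n = L - (\<Sum>i<n. if i \<in> H then \<epsilon> i *\<^sub>R b i else 0)" for n
    by (induction n) (auto simp: X_0 X_Suc \<epsilon>_def)
  have coord: "(\<lambda>n. r u (X n)) \<longlonglongrightarrow> 0" if u: "u \<in> B" for u
  proof -
    define e where "e v n = (if n \<in> G v then norm (b n - norm (b n) *\<^sub>R v) else 0)" for v n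
    define t where "t n = (if n \<in> G u then norm (b n) else 0)" for n
    \<comment> \<open>Summing over \<open>B\<close> gives one summable error sequence that dominates
      the deviation for whichever \<open>v\<close> owns the index.\<close>
    define \<delta> where "\<delta> n = (\<Sum>v\<in>B. K * e v n)" for n
    have e_nonneg: "e v n \<ge> 0" for v n by (simp add: e_def)
    have \<delta>_ge: "K * e v n \<le> \<delta> n" if "v \<in> B" for v n
      using that span(1) \<open>K \<ge> 0\<close> e_nonneg unfolding \<delta>_def
      by (intro member_le_sum[of v B "\<lambda>v. K * e v n"]) auto
    have \<delta>_nonneg: "\<delta> n \<ge> 0" for n
      unfolding \<delta>_def using \<open>K \<ge> 0\<close> e_nonneg by (simp add: sum_nonneg)
    have "(\<lambda>n. \<bar>r u (X n)\<bar>) \<longlonglongrightarrow> 0"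
    proof (rule greedy_tendsto_0)
      show "\<bar>r u (X (Suc n))\<bar> \<le> \<bar>\<bar>r u (X n)\<bar> - t n\<bar> + \<delta> n" for n
      proof (cases "n \<in> H")
        case False
        then have "t n = 0" using u by (auto simp: t_def H_def)
        then show ?thesis using False \<delta>_nonneg[of n] by (simp add: X_Suc)
      next
        case True
        then obtain v where v: "v \<in> B" "n \<in> G v" by (auto simp: H_def)
        define f where "f = b n - norm (b n) *\<^sub>R v"
        have b_eq: "b n = norm (b n) *\<^sub>R v + f" by (simp add: f_def)
        have t_eq: "t n = (if u = v then norm (b n) else 0)"
          using v u disj[of u v] by (auto simp: t_def)
        have rb: "r u (b n) = t n + r u f"
          using r_basis[OF v(1), of u] lin[of u]
          by (subst b_eq) (simp add: linear_add linear_scale t_eq)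
        have "\<bar>r u f\<bar> \<le> \<delta> n"
          using K[OF u, of f] \<delta>_ge[OF v(1), of n] v(2) by (simp add: e_def f_def)
        moreover have "r u (X (Suc n)) = r u (X n) - sg (r v (X n)) * (t n + r u f)"
          using True ch[OF v] lin[of u] by (simp add: X_Suc linear_diff linear_scale rb)
        moreover have "t n = 0" if "u \<noteq> v" using that t_eq by simp
        moreover have "t n \<ge> 0" by (simp add: t_eq)
        \<comment> \<open>For \<open>u = v\<close> the chosen sign turns the main term into a
          subtraction of \<open>t n\<close> from the absolute value; for \<open>u \<noteq> v\<close>
          the main term is 0 and only the error remains.\<close>
        ultimately show ?thesis
          by (cases "u = v") (auto simp: sg_def abs_if split: if_splits)
      qed
      show "t \<longlonglongrightarrow> 0"
        using tendsto_norm_zero[OF b]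
        by (rule Lim_null_comparison[rotated]) (simp add: t_def)
      show "\<not> summable t" using mass[OF u] by (simp add: t_def[abs_def])
      show "summable \<delta>"
        unfolding \<delta>_def using dev by (intro summable_sum summable_mult) (simp add: e_def)
    qed (simp_all add: t_def \<delta>_nonneg)
    then show ?thesis by (rule tendsto_rabs_zero_cancel)
  qed
  have "X n = (\<Sum>u\<in>B. r u (X n) *\<^sub>R u)" for n
    unfolding r_def using real_vector.sum_representation_eq[OF B(1), of "X n" B] span by auto
  moreover have "(\<lambda>n. \<Sum>u\<in>B. r u (X n) *\<^sub>R u) \<longlonglongrightarrow> (\<Sum>u\<in>B. 0 *\<^sub>R u)"
    by (intro tendsto_sum tendsto_scaleR coord tendsto_const)
  ultimately have "X \<longlonglongrightarrow> 0" by simp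
  then have "(\<lambda>n. L - X n) \<longlonglongrightarrow> L - 0" by (intro tendsto_diff tendsto_const)
  then have "(\<lambda>n. if n \<in> (\<Union>u\<in>B. G u) then \<epsilon> n *\<^sub>R b n else 0) sums L"
    by (simp add: sums_def X_eq H_def)
  moreover have "\<epsilon> n \<in> {-1, 1}" for n by (simp add: \<epsilon>_def sg_def)
  ultimately show thesis by (intro that)
qed

text \<open>The Levy condition gives infinite mass near a direction for each fixed
  \<open>\<gamma>\<close>. Steering needs a single index set of infinite mass on which the weighted
  deviation is summable; the extra bound \<open>T\<close> serves to keep the sets of different
  directions disjoint.\<close>

lemma thin_subset:
  fixes f g :: "nat \<Rightarrow> real"
  assumes f: "\<And>n. f n \<ge> 0" "Bseq f" and g: "\<And>n. g n \<ge> 0" and "T > 0"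
    and inf: "\<And>\<gamma>. \<gamma> > 0 \<Longrightarrow> \<not> summable (\<lambda>n. if n \<in> A \<and> g n < \<gamma> then f n else 0)"
  obtains G where "G \<subseteq> {n\<in>A. g n < T}" "\<not> summable (\<lambda>n. if n \<in> G then f n else 0)"
    "summable (\<lambda>n. if n \<in> G then f n * g n else 0)"
proof -
  \<comment> \<open>The admissible deviation decreases with the mass \<open>S n\<close> selected so far, so that the sum of
    \<open>f n * g n\<close> telescopes; \<open>h\<close> stays away from \<open>0\<close> as long as \<open>S\<close> is bounded.\<close>
  define h where "h s = T / (1 + s)\<^sup>2" for s :: real
  define S where "S = rec_nat 0 (\<lambda>n s. s + (if n \<in> A \<and> g n < h s then f n else 0))"
  define G where "G = {n\<in>A. g n < h (S n)}"
  have S_0: "S 0 = 0" and S_Suc: "S (Suc n) = S n + (if n \<in> G then f n else 0)" for n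
    by (simp_all add: S_def G_def)
  have S_eq: "S n = (\<Sum>i<n. if i \<in> G then f i else 0)" for n
    by (induction n) (simp_all add: S_0 S_Suc)
  have S_nonneg: "S n \<ge> 0" for n using f by (simp add: S_eq sum_nonneg)
  have h_mono: "h s \<le> h s'" if "0 \<le> s'" "s' \<le> s" for s s'
    unfolding h_def using that \<open>T > 0\<close> by (intro divide_left_mono power_mono mult_pos_pos) auto
  obtain M where M: "M > 0" "\<And>n. f n \<le> M"
    using f(2) by (auto simp: Bseq_def abs_le_iff)
  show thesis
  proof (rule that)
    show "G \<subseteq> {n\<in>A. g n < T}"
      using h_mono[of 0] S_nonneg by (auto simp: G_def h_def intro: less_le_trans)
    show "\<not> summable (\<lambda>n. if n \<in> G then f n else 0)"
    proof
      assume sum: "summable (\<lambda>n. if n \<in> G then f n else 0)"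
      define s where "s = (\<Sum>n. if n \<in> G then f n else 0)"
      have Ss: "S n \<le> s" for n
        unfolding S_eq s_def using f(1) by (intro sum_le_suminf sum) auto
      have "h s > 0" using \<open>T > 0\<close> S_nonneg[of 0] Ss[of 0] by (simp add: h_def)
      moreover have "summable (\<lambda>n. if n \<in> A \<and> g n < h s then f n else 0)"
        using sum
      proof (rule summable_comparison_test'[where N = 0])
        fix n
        have "h s \<le> h (S n)" using h_mono S_nonneg Ss by simp
        then show "norm (if n \<in> A \<and> g n < h s then f n else 0) \<le> (if n \<in> G then f n else 0)"
          using f(1)[of n] by (auto simp: G_def)
      qed
      ultimately show False using inf by blast
    qed
    have tele: "(if n \<in> G then f n * g n else 0) \<le> T * (1 + M) * (1 / (1 + S n) - 1 / (1 + S (Suc n)))" for n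
    proof (cases "n \<in> G")
      case False
      then show ?thesis by (simp add: S_Suc)
    next
      case True
      have pos: "1 + S n > 0" using S_nonneg[of n] by simp
      \<comment> \<open>Trading one factor \<open>1 / (1 + S n)\<close> of \<open>h (S n)\<close>
        for \<open>(1 + M) / (1 + S (Suc n))\<close> gives a product which, multiplied by the
        increment \<open>f n\<close> of \<open>S\<close>, is a telescoping difference.\<close>
      have "0 \<le> M * S n" using M(1) S_nonneg[of n] by simp
      then have "1 + S (Suc n) \<le> (1 + M) * (1 + S n)"
        using True M(2)[of n] by (simp add: S_Suc algebra_simps)
      moreover have "1 + S (Suc n) > 0" using S_nonneg[of "Suc n"] by simp
      ultimately have *: "1 / (1 + S n) \<le> (1 + M) / (1 + S (Suc n))"
        using pos by (simp add: field_simps)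
      have "f n * g n \<le> f n * h (S n)"
        using True f(1)[of n] by (intro mult_left_mono) (auto simp: G_def)
      also have "\<dots> = T * f n / (1 + S n) * (1 / (1 + S n))" by (simp add: h_def power2_eq_square)
      also have "\<dots> \<le> T * f n / (1 + S n) * ((1 + M) / (1 + S (Suc n)))"
        using * pos f(1)[of n] \<open>T > 0\<close> by (intro mult_left_mono) auto
      also have "\<dots> = T * (1 + M) * (f n / ((1 + S n) * (1 + S (Suc n))))" by simp
      also have "f n / ((1 + S n) * (1 + S (Suc n))) = 1 / (1 + S n) - 1 / (1 + S (Suc n))"
        using True pos \<open>1 + S (Suc n) > 0\<close> by (simp add: S_Suc field_simps)
      finally show ?thesis using True by simp
    qed
    show "summable (\<lambda>n. if n \<in> G then f n * g n else 0)"
    proof (rule bounded_imp_summable)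
      show "0 \<le> (if n \<in> G then f n * g n else 0)" for n using f g by simp
      fix n
      have "(\<Sum>k\<le>n. if k \<in> G then f k * g k else 0) \<le>
          (\<Sum>k\<le>n. T * (1 + M) * (1 / (1 + S k) - 1 / (1 + S (Suc k))))"
        by (intro sum_mono tele)
      also have "\<dots> = T * (1 + M) * (1 - 1 / (1 + S (Suc n)))"
        using sum_telescope[of "\<lambda>k. 1 / (1 + S k)" n]
        by (simp only: sum_distrib_left[symmetric]) (simp add: S_0)
      also have "\<dots> \<le> T * (1 + M)"
        using \<open>T > 0\<close> M S_nonneg[of "Suc n"] by (intro mult_left_le) auto
      finally show "(\<Sum>k\<le>n. if k \<in> G then f k * g k else 0) \<le> T * (1 + M)" .
    qed
  qed
qed

text \<open>Pigeonhole over residues: if each class had a scale \<open>\<gamma> r\<close> with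
  summable part, then by monotonicity the smallest of these finitely many scales would make all
  parts, and hence \<open>f\<close>, summable.\<close>

lemma divergent_residue_class:
  fixes f :: "real \<Rightarrow> nat \<Rightarrow> real"
  assumes "m > 0" and f: "\<And>\<gamma> n. f \<gamma> n \<ge> 0" "\<And>\<gamma> \<gamma>' n. \<gamma> \<le> \<gamma>' \<Longrightarrow> f \<gamma> n \<le> f \<gamma>' n"
    and inf: "\<And>\<gamma>. \<gamma> > 0 \<Longrightarrow> \<not> summable (f \<gamma>)"
  obtains r where "r < m" "\<And>\<gamma>. \<gamma> > 0 \<Longrightarrow> \<not> summable (\<lambda>n. if n mod m = r then f \<gamma> n else 0)"
proof (rule ccontr)
  assume "\<not> thesis"
  then have "\<forall>r. \<exists>\<gamma>. r < m \<longrightarrow> \<gamma> > 0 \<and> summable (\<lambda>n. if n mod m = r then f \<gamma> n else 0)"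
    using that by blast
  then obtain \<gamma> where \<gamma>: "\<And>r. r < m \<Longrightarrow> \<gamma> r > 0"
    "\<And>r. r < m \<Longrightarrow> summable (\<lambda>n. if n mod m = r then f (\<gamma> r) n else 0)"
    by metis
  define \<gamma>0 where "\<gamma>0 = Min (\<gamma> ` {..<m})"
  have ne: "\<gamma> ` {..<m} \<noteq> {}" using \<open>m > 0\<close> by auto
  have "\<gamma>0 > 0" using \<gamma>(1) ne by (simp add: \<gamma>0_def)
  have "summable (\<lambda>n. if n mod m = r then f \<gamma>0 n else 0)" if "r < m" for r
    using \<gamma>(2)[OF that]
  proof (rule summable_comparison_test'[where N = 0])
    fix n
    have "\<gamma>0 \<le> \<gamma> r" using that by (simp add: \<gamma>0_def)
    then show "norm (if n mod m = r then f \<gamma>0 n else 0) \<le> (if n mod m = r then f (\<gamma> r) n else 0)"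
      using f(1)[of \<gamma>0 n] f(2) by simp
  qed
  then have "summable (\<lambda>n. \<Sum>r<m. if n mod m = r then f \<gamma>0 n else 0)"
    by (intro summable_sum) auto
  moreover have "(\<Sum>r<m. if n mod m = r then f \<gamma>0 n else 0) = f \<gamma>0 n" for n
    using \<open>m > 0\<close> by simp
  ultimately have "summable (f \<gamma>0)" by (simp only:)
  with inf[OF \<open>\<gamma>0 > 0\<close>] show False by contradiction
qed

text \<open>A partial sum differs from a sum of complete blocks by fewer than \<open>m\<close>
  terms, all of which tend to 0.\<close>

lemma summable_from_blocks:
  fixes z :: "nat \<Rightarrow> 'a::real_normed_vector"
  assumes "m > 0" and z: "z \<longlonglongrightarrow> 0" and blocks: "summable (\<lambda>k. \<Sum>i<m. z (m * k + i))"
  shows "summable z"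
proof -
  obtain s where s: "(\<lambda>N. \<Sum>k<N. \<Sum>i<m. z (m * k + i)) \<longlonglongrightarrow> s"
    using blocks by (auto simp: summable_def sums_def)
  have split: "(\<Sum>n<M + k. z n) = (\<Sum>n<M. z n) + (\<Sum>i<k. z (M + i))" for M k
    by (induction k) (simp_all add: add.assoc)
  have blk: "(\<Sum>k<N. \<Sum>i<m. z (m * k + i)) = (\<Sum>n<m * N. z n)" for N
  proof (induction N)
    case (Suc N)
    then show ?case using split[of "m * N" m] by (simp add: add.commute)
  qed simp
  have lim: "filterlim (\<lambda>n. n div m) at_top sequentially"
    unfolding filterlim_at_top eventually_sequentially
  proof (intro allI exI impI)
    fix Z n assume "m * Z \<le> n"
    then have "m * Z div m \<le> n div m" by (rule div_le_mono)
    then show "Z \<le> n div m" using \<open>m > 0\<close> by simp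
  qed
  have "(\<lambda>N. \<Sum>n<m * (N div m). z n) \<longlonglongrightarrow> s"
    using filterlim_compose[OF s lim] by (simp add: blk)
  \<comment> \<open>The incomplete block is padded with zeros to the fixed length \<open>m\<close>,
    so that limits can be taken term by term.\<close>
  moreover have "(\<lambda>N. \<Sum>n<m. if n < N mod m then z (m * (N div m) + n) else 0) \<longlonglongrightarrow> (\<Sum>n<m. 0)"
  proof (rule tendsto_sum)
    fix i assume "i \<in> {..<m}"
    have "filterlim (\<lambda>N. m * (N div m) + i) at_top sequentially"
      using lim by (rule filterlim_at_top_mono) (use \<open>m > 0\<close> in \<open>simp add: trans_le_add1\<close>)
    then have "(\<lambda>N. z (m * (N div m) + i)) \<longlonglongrightarrow> 0" using z by (rule filterlim_compose[rotated])
    from tendsto_norm_zero[OF this]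
    show "(\<lambda>N. if i < N mod m then z (m * (N div m) + i) else 0) \<longlonglongrightarrow> 0"
      by (rule Lim_null_comparison[rotated]) simp
  qed
  ultimately have "(\<lambda>N. (\<Sum>n<m * (N div m). z n) +
      (\<Sum>n<m. if n < N mod m then z (m * (N div m) + n) else 0)) \<longlonglongrightarrow> s + (\<Sum>n<m. 0)"
    by (rule tendsto_add)
  moreover have "(\<Sum>n<m * (N div m). z n) +
      (\<Sum>n<m. if n < N mod m then z (m * (N div m) + n) else 0) = (\<Sum>n<N. z n)" for N
  proof -
    have "(\<Sum>n<m. if n < N mod m then z (m * (N div m) + n) else 0) =
        (\<Sum>n<N mod m. z (m * (N div m) + n))"
      using mod_less_divisor[OF \<open>m > 0\<close>, of N] by (intro sum.mono_neutral_cong_right) auto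
    then show ?thesis using split[of "m * (N div m)" "N mod m"] by simp
  qed
  ultimately have "(\<lambda>N. \<Sum>n<N. z n) \<longlonglongrightarrow> s" by simp
  then show ?thesis by (auto simp: summable_def sums_def)
qed

lemma exists_half_separation:
  fixes B :: "'a::metric_space set"
  assumes "finite B"
  obtains T where "T > 0" "\<And>u v. u \<in> B \<Longrightarrow> v \<in> B \<Longrightarrow> u \<noteq> v \<Longrightarrow> 2 * T \<le> dist u v"
proof
  \<comment> \<open>The inserted 1 keeps \<open>S\<close> nonempty when \<open>B\<close> has no two
    distinct points.\<close>
  define S where "S = insert 1 ((\<lambda>(u, v). dist u v / 2) ` {(u, v) \<in> B \<times> B. u \<noteq> v})"
  have "finite {(u, v) \<in> B \<times> B. u \<noteq> v}"
    by (rule finite_subset[of _ "B \<times> B"]) (use assms in auto)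
  then have S: "finite S" "S \<noteq> {}" by (simp_all add: S_def)
  show "Min S > 0" using S by (auto simp: S_def)
  show "2 * Min S \<le> dist u v" if "u \<in> B" "v \<in> B" "u \<noteq> v" for u v
  proof -
    have "dist u v / 2 \<in> S" using that by (force simp: S_def)
    then have "Min S \<le> dist u v / 2" using S by (intro Min_le)
    then show ?thesis by simp
  qed
qed

text \<open>The signs outside \<^term>\<open>Q\<close> are prescribed only up to a sign per block of length \<^term>\<open>m\<close>;
  these block signs make the block sums converge, whatever \<^term>\<open>p\<close> is.\<close>

lemma signed_sums_with_pattern:
  fixes b :: "nat \<Rightarrow> 'a::euclidean_space"
  assumes b: "b \<longlonglongrightarrow> 0"
    and B: "independent B" "card B = DIM('a)"
    and levy: "\<And>u \<gamma>. u \<in> B \<Longrightarrow> \<gamma> > 0 \<Longrightarrow>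
      \<not> summable (\<lambda>n. if b n /\<^sub>R norm (b n) \<in> ball u \<gamma> then norm (b n) else 0)"
    and m: "m > DIM('a)"
  obtains Q q where "Q \<subseteq> {..<m}" "q \<in> Q" "card Q \<le> DIM('a) + 1"
    "\<And>L p. (\<And>n. p n \<in> {-1, 1 :: real}) \<Longrightarrow> \<exists>\<epsilon>. (\<forall>n. \<epsilon> n \<in> {-1, 1}) \<and>
      (\<lambda>n. \<epsilon> n *\<^sub>R b n) sums L \<and> (\<forall>n. n mod m \<notin> Q \<longrightarrow> \<epsilon> n * \<epsilon> (m * (n div m) + q) = p n)"
proof -
  have "m > 0" using m by simp
  have "finite B" using dimension_basis_span_UNIV[OF B] by simp
  obtain T where T: "T > 0" "\<And>u v. u \<in> B \<Longrightarrow> v \<in> B \<Longrightarrow> u \<noteq> v \<Longrightarrow> 2 * T \<le> dist u v"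
    using exists_half_separation[OF \<open>finite B\<close>] by blast
  define g where "g u n = dist u (b n /\<^sub>R norm (b n))" for u n
  have "\<forall>u\<in>B. \<exists>r. r < m \<and>
      (\<forall>\<gamma>>0. \<not> summable (\<lambda>n. if n mod m = r then if g u n < \<gamma> then norm (b n) else 0 else 0))"
  proof
    fix u assume u: "u \<in> B"
    show "\<exists>r. r < m \<and>
      (\<forall>\<gamma>>0. \<not> summable (\<lambda>n. if n mod m = r then if g u n < \<gamma> then norm (b n) else 0 else 0))"
    proof (rule divergent_residue_class[of m "\<lambda>\<gamma> n. if g u n < \<gamma> then norm (b n) else 0"])
      show "\<not> summable (\<lambda>n. if g u n < \<gamma> then norm (b n) else 0)" if "\<gamma> > 0" for \<gamma>
        using levy[OF u that] by (simp add: g_def)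
    qed (use \<open>m > 0\<close> in auto)
  qed
  from bchoice[OF this] obtain r where r: "\<And>u. u \<in> B \<Longrightarrow> r u < m"
    "\<And>u \<gamma>. u \<in> B \<Longrightarrow> \<gamma> > 0 \<Longrightarrow>
      \<not> summable (\<lambda>n. if n mod m = r u then if g u n < \<gamma> then norm (b n) else 0 else 0)"
    by blast
  have "Bseq (\<lambda>n. norm (b n))"
    using b by (intro convergent_imp_Bseq convergentI[OF tendsto_norm])
  have "\<forall>u\<in>B. \<exists>G. G \<subseteq> {n. n mod m = r u \<and> g u n < T} \<and>
      \<not> summable (\<lambda>n. if n \<in> G then norm (b n) else 0) \<and>
      summable (\<lambda>n. if n \<in> G then norm (b n) * g u n else 0)"
  proof
    fix u assume u: "u \<in> B"
    show "\<exists>G. G \<subseteq> {n. n mod m = r u \<and> g u n < T} \<and>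
      \<not> summable (\<lambda>n. if n \<in> G then norm (b n) else 0) \<and>
      summable (\<lambda>n. if n \<in> G then norm (b n) * g u n else 0)"
    proof (rule thin_subset[of "\<lambda>n. norm (b n)" "g u" T "{n. n mod m = r u}"])
      show "\<not> summable (\<lambda>n. if n \<in> {n. n mod m = r u} \<and> g u n < \<gamma> then norm (b n) else 0)"
        if "\<gamma> > 0" for \<gamma>
        using r(2)[OF u that] by (simp add: if_if_eq_conj)
    qed (use \<open>Bseq (\<lambda>n. norm (b n))\<close> T(1) in \<open>auto simp: g_def\<close>)
  qed
  from bchoice[OF this] obtain G where G_all: "\<forall>u\<in>B. G u \<subseteq> {n. n mod m = r u \<and> g u n < T} \<and>
      \<not> summable (\<lambda>n. if n \<in> G u then norm (b n) else 0) \<and>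
      summable (\<lambda>n. if n \<in> G u then norm (b n) * g u n else 0)" ..
  note G = bspec[OF G_all, THEN conjunct1] bspec[OF G_all, THEN conjunct2, THEN conjunct1]
    bspec[OF G_all, THEN conjunct2, THEN conjunct2]
  have disj: "G u \<inter> G v = {}" if uv: "u \<in> B" "v \<in> B" "u \<noteq> v" for u v
  proof (rule ccontr)
    assume "G u \<inter> G v \<noteq> {}"
    then obtain n where "n \<in> G u" "n \<in> G v" by blast
    then have "g u n < T" "g v n < T" using G(1)[OF uv(1)] G(1)[OF uv(2)] by blast+
    moreover have "dist u v \<le> g u n + g v n"
      unfolding g_def by (rule dist_triangle2)
    ultimately show False using T(2)[OF uv] by simp
  qed
  \<comment> \<open>Identifies the weighted deviation made summable by \<open>thin_subset\<close>
    with the one that \<open>steering\<close> asks for.\<close>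
  have norm_dev: "norm (b n - norm (b n) *\<^sub>R u) = norm (b n) * g u n" for u n
  proof (cases "b n = 0")
    case False
    then have "b n - norm (b n) *\<^sub>R u = norm (b n) *\<^sub>R (b n /\<^sub>R norm (b n) - u)"
      by (simp add: algebra_simps)
    then show ?thesis by (simp add: g_def dist_norm norm_minus_commute)
  qed simp
  have dev: "summable (\<lambda>n. if n \<in> G u then norm (b n - norm (b n) *\<^sub>R u) else 0)"
    if "u \<in> B" for u
    unfolding norm_dev by (rule G(3)[OF that])
  define H where "H = (\<Union>u\<in>B. G u)"
  \<comment> \<open>Steering terms occupy at most \<open>DIM('a)\<close> residues, so some residue
    \<open>q\<close> carries none; its position will display the block sign.\<close>
  have "card (r ` B) \<le> DIM('a)" using card_image_le[OF \<open>finite B\<close>, of r] B(2) by simp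
  then have "\<not> {..<m} \<subseteq> r ` B"
    using m card_mono[of "r ` B" "{..<m}"] \<open>finite B\<close> by auto
  then obtain q where q: "q < m" "q \<notin> r ` B" by auto
  define Q where "Q = insert q (r ` B)"
  have H: "n mod m \<in> Q" "n mod m \<noteq> q" if n: "n \<in> H" for n
  proof -
    obtain u where u: "u \<in> B" "n \<in> G u" using n unfolding H_def by blast
    then have "n mod m = r u" using G(1)[OF u(1)] by blast
    then show "n mod m \<in> Q" "n mod m \<noteq> q" using u(1) q(2) by (auto simp: Q_def)
  qed
  show thesis
  proof (rule that)
    show "Q \<subseteq> {..<m}" "q \<in> Q" using r(1) q by (auto simp: Q_def)
    show "card Q \<le> DIM('a) + 1"
      using card_insert_le_m1[of "DIM('a) + 1" "r ` B" q] \<open>card (r ` B) \<le> DIM('a)\<close>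
      by (simp add: Q_def)
    fix L and p :: "nat \<Rightarrow> real"
    assume p: "\<And>n. p n \<in> {-1, 1}"
    \<comment> \<open>With value 1 on \<open>Q\<close>, position \<open>q\<close> of block
      \<open>k\<close> ends up with exactly the block sign \<open>\<sigma> k\<close>.\<close>
    define p' where "p' n = (if n mod m \<in> Q then 1 else p n)" for n
    have p': "p' n \<in> {-1, 1}" for n using p by (simp add: p'_def)
    define c where "c n = (if n \<in> H then 0 else p' n *\<^sub>R b n)" for n
    have norm_p': "\<bar>p' n\<bar> = 1" for n using p'[of n] by auto
    have c: "c \<longlonglongrightarrow> 0"
      using tendsto_norm_zero[OF b] by (rule Lim_null_comparison[rotated]) (simp add: c_def norm_p')
    define y where "y k = (\<Sum>i<m. c (m * k + i))" for k
    have "(\<lambda>k. c (m * k + i)) \<longlonglongrightarrow> 0" for i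
    proof (rule filterlim_compose[OF c])
      have "strict_mono (\<lambda>k. m * k + i)" using \<open>m > 0\<close> by (simp add: strict_mono_def)
      then show "filterlim (\<lambda>k. m * k + i) at_top sequentially" by (rule filterlim_subseq)
    qed
    then have "y \<longlonglongrightarrow> (\<Sum>i<m. 0)" unfolding y_def by (intro tendsto_sum)
    then obtain \<sigma> :: "nat \<Rightarrow> real"
      where \<sigma>: "\<And>k. \<sigma> k \<in> {-1, 1}" "summable (\<lambda>k. \<sigma> k *\<^sub>R y k)"
      using signs_summable[of y] by auto
    have norm_\<sigma>: "\<bar>\<sigma> k\<bar> = 1" for k using \<sigma>(1)[of k] by auto
    define z where "z n = \<sigma> (n div m) *\<^sub>R c n" for n
    have "summable z"
    proof (rule summable_from_blocks[OF \<open>m > 0\<close>])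
      show "z \<longlonglongrightarrow> 0"
        using tendsto_norm_zero[OF c] by (rule Lim_null_comparison[rotated]) (simp add: z_def norm_\<sigma>)
      have "(\<Sum>i<m. z (m * k + i)) = \<sigma> k *\<^sub>R y k" for k
        unfolding y_def scaleR_sum_right by (intro sum.cong) (auto simp: z_def)
      then show "summable (\<lambda>k. \<Sum>i<m. z (m * k + i))" using \<sigma>(2) by simp
    qed
    \<comment> \<open>The steered terms have to supply what the convergent freely signed part leaves
      open.\<close>
    obtain \<epsilon>' :: "nat \<Rightarrow> real" where \<epsilon>': "\<And>n. \<epsilon>' n \<in> {-1, 1}"
      "(\<lambda>n. if n \<in> H then \<epsilon>' n *\<^sub>R b n else 0) sums (L - suminf z)"
      using steering[OF b B disj G(2) dev, where L = "L - suminf z"] unfolding H_def by blast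
    define \<epsilon> where "\<epsilon> n = (if n \<in> H then \<epsilon>' n else \<sigma> (n div m) * p' n)" for n
    have "(\<lambda>n. z n + (if n \<in> H then \<epsilon>' n *\<^sub>R b n else 0)) sums (suminf z + (L - suminf z))"
      by (intro sums_add summable_sums \<open>summable z\<close> \<epsilon>'(2))
    moreover have "z n + (if n \<in> H then \<epsilon>' n *\<^sub>R b n else 0) = \<epsilon> n *\<^sub>R b n" for n
      by (simp add: z_def c_def \<epsilon>_def)
    ultimately have "(\<lambda>n. \<epsilon> n *\<^sub>R b n) sums L" by simp
    moreover have "\<epsilon> n \<in> {-1, 1}" for n
      using \<epsilon>'(1)[of n] \<sigma>(1)[of "n div m"] p'[of n] by (auto simp: \<epsilon>_def)
    \<comment> \<open>Both factors carry the same block sign, whose square is 1, so the product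
      returns the prescribed sign.\<close>
    moreover have "\<epsilon> n * \<epsilon> (m * (n div m) + q) = p n" if n: "n mod m \<notin> Q" for n
    proof -
      define j where "j = m * (n div m) + q"
      have j: "j mod m = q" "j div m = n div m" using q(1) by (simp_all add: j_def)
      then have "j \<notin> H" using H(2) by blast
      then have "\<epsilon> j = \<sigma> (n div m)" using j by (simp add: \<epsilon>_def p'_def Q_def)
      moreover have "\<epsilon> n = \<sigma> (n div m) * p n" using n H(1) by (auto simp: \<epsilon>_def p'_def)
      ultimately show ?thesis using \<sigma>(1)[of "n div m"] by (auto simp: j_def)
    qed
    ultimately show "\<exists>\<epsilon>. (\<forall>n. \<epsilon> n \<in> {-1, 1}) \<and> (\<lambda>n. \<epsilon> n *\<^sub>R b n) sums L \<and>
        (\<forall>n. n mod m \<notin> Q \<longrightarrow> \<epsilon> n * \<epsilon> (m * (n div m) + q) = p n)" by blast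
  qed
qed

section \<open>Hausdorff measure of sets of sign sequences\<close>

lemma dist_sign_seq_lt_imp_eq:
  assumes "dist \<epsilon> \<omega> < (1/2) ^ N" "1 \<le> n" "n \<le> N"
  shows "sign_at \<epsilon> n = sign_at \<omega> n"
proof (rule ccontr)
  assume ne: "sign_at \<epsilon> n \<noteq> sign_at \<omega> n"
  then have "first_diff \<epsilon> \<omega> \<le> N"
    using assms(2,3) Least_le[of "\<lambda>n. n \<ge> 1 \<and> sign_at \<epsilon> n \<noteq> sign_at \<omega> n" n]
    by (simp add: first_diff_def)
  then have "(2::real) powr - real N \<le> 2 powr - real (first_diff \<epsilon> \<omega>)" by simp
  also have "\<dots> = dist \<epsilon> \<omega>" using ne by (auto simp: dist_sign_seq_def)
  finally show False using assms(1) by (simp add: powr_minus powr_realpow power_one_over inverse_eq_divide)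
qed

lemma dist_sign_seq_le:
  assumes "\<And>n. 1 \<le> n \<Longrightarrow> n \<le> N \<Longrightarrow> sign_at \<epsilon> n = sign_at \<omega> n"
  shows "dist \<epsilon> \<omega> \<le> (1/2) ^ Suc N"
proof (cases "\<epsilon> = \<omega>")
  case False
  then obtain k where "k \<ge> 1 \<and> sign_at \<epsilon> k \<noteq> sign_at \<omega> k" by (blast elim: sign_seq_neqE)
  then have "first_diff \<epsilon> \<omega> \<ge> 1 \<and> sign_at \<epsilon> (first_diff \<epsilon> \<omega>) \<noteq> sign_at \<omega> (first_diff \<epsilon> \<omega>)"
    unfolding first_diff_def by (rule LeastI)
  then have "Suc N \<le> first_diff \<epsilon> \<omega>" using assms by (meson not_less_eq_eq)
  then have "(2::real) powr - real (first_diff \<epsilon> \<omega>) \<le> 2 powr - real (Suc N)"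
    by (intro powr_mono) auto
  also have "\<dots> = (1/2) ^ Suc N"
    by (simp only: powr_minus powr_realpow zero_less_numeral power_one_over inverse_eq_divide)
  finally show ?thesis using False by (simp add: dist_sign_seq_def)
qed simp

lemma diameter_le_dist:
  fixes S :: "'a::metric_space set"
  assumes "\<And>x y. x \<in> S \<Longrightarrow> y \<in> S \<Longrightarrow> dist x y \<le> \<delta>" "0 \<le> \<delta>"
  shows "diameter S \<le> \<delta>"
  unfolding diameter_def using assms by (auto intro!: cSUP_least)

text \<open>The \<open>2 ^ N\<close> cylinders of length \<open>N\<close> have gauge at most
  \<open>((1/2) ^ N) powr s\<close> each, so together at most \<open>x ^ N\<close>, and
  \<open>x < 1\<close> because \<open>s > 1\<close>.\<close>

lemma hausdorff_measure_sign_seq_eq_0: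
  fixes A :: "sign_seq set"
  assumes "s > 1"
  shows "hausdorff_measure s A = 0"
proof -
  define x where "x = 2 * (1/2::real) powr s"
  have "(1/2::real) powr s < (1/2) powr 1"
    using assms by (intro powr_less_mono') auto
  then have x: "0 \<le> x" "x < 1" by (simp_all add: x_def)
  have "hausdorff_premeasure \<delta> s A \<le> 0" if \<delta>: "\<delta> > 0" for \<delta>
  proof (rule LIMSEQ_le_const)
    show "(\<lambda>N. ennreal (x ^ N)) \<longlonglongrightarrow> 0"
      using tendsto_ennrealI[OF LIMSEQ_power_zero[of x]] x by simp
    obtain N0 where N0: "(1/2::real) ^ N0 < \<delta>"
      using real_arch_pow_inv[OF \<delta>, of "1/2"] by auto
    have "hausdorff_premeasure \<delta> s A \<le> ennreal (x ^ N)" if N: "N \<ge> N0" for N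
    proof -
      \<comment> \<open>The bits of \<open>i\<close> list the first \<open>N\<close> signs; from
        \<open>2 ^ N\<close> on, empty sets of gauge 0 fill up the sequence.\<close>
      define U :: "nat \<Rightarrow> sign_seq set"
        where "U i = (if i < 2 ^ N then {\<epsilon>. \<forall>n<N. (sign_at \<epsilon> (Suc n) = 1) = bit i n} else {})" for i
      have val: "sign_at \<epsilon> (Suc n) \<in> {-1, 1}" for \<epsilon> n
        using sign_at[of \<epsilon>] by (auto simp: PiE_def Pi_def)
      have dist: "dist \<epsilon> \<omega> \<le> (1/2) ^ Suc N" if "\<epsilon> \<in> U i" "\<omega> \<in> U i" for \<epsilon> \<omega> i
      proof (rule dist_sign_seq_le)
        fix n assume "1 \<le> n" "n \<le> N"
        then obtain k where k: "n = Suc k" "k < N" by (cases n) auto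
        then show "sign_at \<epsilon> n = sign_at \<omega> n"
          using that val[of \<epsilon> k] val[of \<omega> k] by (auto simp: U_def split: if_splits)
      qed
      have diam: "diameter (U i) \<le> (1/2) ^ Suc N" for i
        using dist by (rule diameter_le_dist) auto
      have bdd: "bounded (U i)" for i
        using dist unfolding bounded_def by blast
      have "(1/2::real) ^ Suc N \<le> (1/2) ^ N0"
        using N by (intro power_decreasing) auto
      then have diam_\<delta>: "diameter (U i) \<le> \<delta>" for i
        using diam[of i] N0 by linarith
      have cover: "A \<subseteq> (\<Union>i. U i)"
      proof
        fix \<epsilon>
        define i :: nat where "i = horner_sum of_bool 2 (map (\<lambda>n. sign_at \<epsilon> (Suc n) = 1) [0..<N])"
        have "i < 2 ^ N"
          using horner_sum_of_bool_2_less[of "map (\<lambda>n. sign_at \<epsilon> (Suc n) = 1) [0..<N]"]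
          by (simp add: i_def)
        then have "\<epsilon> \<in> U i"
          by (auto simp: U_def i_def bit_horner_sum_bit_iff)
        then show "\<epsilon> \<in> (\<Union>i. U i)" by blast
      qed
      have "hausdorff_premeasure \<delta> s A \<le> (\<Sum>i. hausdorff_gauge s (U i))"
        unfolding hausdorff_premeasure_def using cover bdd diam_\<delta> by (intro INF_lower) auto
      also have "\<dots> = (\<Sum>i<2 ^ N. hausdorff_gauge s (U i))"
        by (intro suminf_finite) (auto simp: U_def hausdorff_gauge_def)
      also have "\<dots> \<le> (\<Sum>i<(2::nat) ^ N. ennreal (((1/2) ^ N) powr s))"
      proof (rule sum_mono)
        fix i :: nat
        have "diameter (U i) \<le> (1/2) ^ N"
          using diam[of i] power_decreasing[of N "Suc N" "1/2::real"] by linarith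
        moreover have "0 \<le> diameter (U i)" using bdd by (rule diameter_ge_0)
        ultimately show "hausdorff_gauge s (U i) \<le> ennreal (((1/2) ^ N) powr s)"
          using assms by (auto simp: hausdorff_gauge_def intro!: ennreal_leI powr_mono2)
      qed
      also have "\<dots> = ennreal (2 ^ N * ((1/2) ^ N) powr s)"
        by (simp add: ennreal_mult ennreal_power[symmetric])
      also have "2 ^ N * ((1/2::real) ^ N) powr s = x ^ N"
        by (simp add: x_def power_mult_distrib powr_power powr_realpow[symmetric] powr_powr mult.commute)
      finally show ?thesis .
    qed
    then show "\<exists>N. \<forall>n\<ge>N. hausdorff_premeasure \<delta> s A \<le> ennreal (x ^ n)" by blast
  qed
  then show ?thesis by (simp add: hausdorff_measure_def)
qed

lemma hausdorff_dim_sign_seq_le_1: "hausdorff_dim (A :: sign_seq set) \<le> 1"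
proof (rule ennreal_le_epsilon)
  fix e :: real assume "e > 0"
  then have "hausdorff_dim A \<le> ennreal (1 + e)"
    unfolding hausdorff_dim_def by (intro INF_lower) (simp add: hausdorff_measure_sign_seq_eq_0)
  then show "hausdorff_dim A \<le> 1 + ennreal e" using \<open>e > 0\<close> by simp
qed

section \<open>Coin tossing and the lower bound for Hausdorff measure\<close>

abbreviation coin_space :: "(nat \<Rightarrow> bool) measure" where
  "coin_space \<equiv> PiM UNIV (\<lambda>_. measure_pmf (bernoulli_pmf (1/2)))"

interpretation coin: product_prob_space "\<lambda>_::nat. measure_pmf (bernoulli_pmf (1/2))" UNIV ..

lemma space_coin_space: "space coin_space = UNIV"
  by (simp add: space_PiM)

lemma sets_coin_cylinder: "{x. \<forall>i\<in>J. x i = c i} \<in> sets coin_space"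
proof -
  have [measurable]: "(\<lambda>x. x i) \<in> measurable coin_space (count_space UNIV)" for i
    using measurable_component_singleton[of i UNIV "\<lambda>_. measure_pmf (bernoulli_pmf (1/2))"] by simp
  have "{x\<in>space coin_space. \<forall>i\<in>J. x i = c i} \<in> sets coin_space" by measurable
  then show ?thesis by (simp add: space_coin_space)
qed

lemma measure_coin_cylinder:
  assumes "finite J"
  shows "measure coin_space {x. \<forall>i\<in>J. x i = c i} = (1/2) ^ card J"
proof -
  have half: "emeasure (measure_pmf (bernoulli_pmf (1/2))) {b} = ennreal (1/2)" for b
    by (cases b) (simp_all add: emeasure_pmf_single)
  have "emeasure coin_space {x. \<forall>i\<in>J. x i = c i} =
      (\<Prod>i\<in>J. emeasure (measure_pmf (bernoulli_pmf (1/2))) {c i})"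
    using coin.emeasure_PiM_Collect[of J "\<lambda>i. {c i}"] assms by (simp add: space_PiM)
  also have "\<dots> = ennreal ((1/2) ^ card J)"
    by (simp only: half prod_constant ennreal_power)
  finally show ?thesis by (intro measure_eq_emeasure_eq_ennreal) auto
qed

text \<open>Counts the free bits in the first \<open>K\<close> blocks, which is the exponent in the
  coin measure of the corresponding cylinder.\<close>

lemma card_residues_below:
  assumes "Q \<subseteq> {..<m}"
  shows "finite {n. n < m * K \<and> n mod m \<notin> Q}"
    and "card {n. n < m * K \<and> n mod m \<notin> Q} = K * (m - card Q)"
proof -
  show "finite {n. n < m * K \<and> n mod m \<notin> Q}" by simp
  show "card {n. n < m * K \<and> n mod m \<notin> Q} = K * (m - card Q)"
  proof (induction K)
    case (Suc K)
    have eq: "{n. n < m * Suc K \<and> n mod m \<notin> Q} =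
        {n. n < m * K \<and> n mod m \<notin> Q} \<union> (\<lambda>i. m * K + i) ` ({..<m} - Q)" (is "?A = ?B \<union> ?C")
    proof (intro set_eqI iffI)
      fix n assume n: "n \<in> ?A"
      show "n \<in> ?B \<union> ?C"
      proof (cases "n < m * K")
        case False
        then obtain i where i: "n = m * K + i" by (metis le_add_diff_inverse not_less)
        then have "i < m" using n by simp
        then show ?thesis using n i by auto
      qed (use n in simp)
    qed auto
    have "card ((\<lambda>i. m * K + i) ` ({..<m} - Q)) = m - card Q"
      using assms by (subst card_image) (auto simp: card_Diff_subset finite_subset inj_on_def)
    then show ?case
      unfolding eq using Suc by (subst card_Un_disjoint) auto
  qed simp
qed

text \<open>Mass distribution principle, with the mass of a set of sign sequences measured by the fair
  coin-tossing measure of the bits that it encodes.\<close>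

lemma hausdorff_measure_sign_seq_pos:
  fixes E :: "sign_seq set" and s :: real
  assumes Q: "Q \<subseteq> {..<m}" "q \<in> Q" "card Q < m" and s: "0 \<le> s" "s * m \<le> m - card Q"
    and E: "\<And>p :: nat \<Rightarrow> bool. \<exists>\<epsilon>\<in>E. \<forall>n. n mod m \<notin> Q \<longrightarrow>
      (sign_at \<epsilon> (Suc n) * sign_at \<epsilon> (Suc (m * (n div m) + q)) = 1) = p n"
  shows "hausdorff_measure s E \<noteq> 0"
proof -
  \<comment> \<open>Bit \<open>n\<close> compares a sign with the one at the reference position of
    its block, so an unknown common sign of the block cancels. Bits start at 0 and signs at 1, hence
    \<open>Suc\<close>.\<close>
  define D where
    "D \<epsilon> n = (sign_at \<epsilon> (Suc n) * sign_at \<epsilon> (Suc (m * (n div m) + q)) = 1)" for \<epsilon> n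
  define J where "J K = {n. n < m * K \<and> n mod m \<notin> Q}" for K
  \<comment> \<open>The bit sequences encoded by members of \<open>U\<close>, with bits at residues
    in \<open>Q\<close> left arbitrary. Measurability of \<open>V U\<close> is not claimed;
    measurable supersets \<open>W\<close> are estimated instead.\<close>
  define V where "V U = {p. \<exists>\<epsilon>\<in>U. \<forall>n. n mod m \<notin> Q \<longrightarrow> D \<epsilon> n = p n}" for U
  define C :: real where "C = 2 ^ m"
  have "m > 0" "q < m" using Q by auto
  note J = card_residues_below[OF Q(1), folded J_def]
  have cyl_prob: "measure coin_space {p. \<forall>n\<in>J K. p n = c n} = (1/2) ^ (K * (m - card Q))" for K c
    using measure_coin_cylinder[OF J(1)] by (simp add: J(2))
  \<comment> \<open>Both positions read by \<open>D\<close> lie in the same block, so agreement on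
    \<open>K\<close> complete blocks fixes all bits in \<open>J K\<close>.\<close>
  have V_cyl: "V U \<subseteq> {p. \<forall>n\<in>J K. p n = D \<epsilon>0 n}"
    if agree: "\<And>\<epsilon> n. \<epsilon> \<in> U \<Longrightarrow> 1 \<le> n \<Longrightarrow> n \<le> m * K \<Longrightarrow> sign_at \<epsilon> n = sign_at \<epsilon>0 n" for U K \<epsilon>0
  proof
    fix p assume "p \<in> V U"
    then obtain \<epsilon> where \<epsilon>: "\<epsilon> \<in> U" "\<And>n. n mod m \<notin> Q \<Longrightarrow> D \<epsilon> n = p n"
      by (auto simp: V_def)
    have "D \<epsilon> n = D \<epsilon>0 n" if n: "n \<in> J K" for n
    proof -
      have "n < m * K" using n by (simp add: J_def)
      then have "Suc (n div m) \<le> K"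
        using \<open>m > 0\<close> by (simp add: less_mult_imp_div_less mult.commute Suc_le_eq)
      then have "m * Suc (n div m) \<le> m * K" by (rule mult_le_mono2)
      then have "Suc (m * (n div m) + q) \<le> m * K" using \<open>q < m\<close> by simp
      then show ?thesis
        using agree[OF \<epsilon>(1)] \<open>n < m * K\<close> by (simp add: D_def Suc_le_eq)
    qed
    then show "p \<in> {p. \<forall>n\<in>J K. p n = D \<epsilon>0 n}" using \<epsilon>(2) by (auto simp: J_def)
  qed
  have gauge: "\<exists>W\<in>sets coin_space. V U \<subseteq> W \<and> emeasure coin_space W \<le> ennreal C * hausdorff_gauge s U"
    if U: "bounded U" "diameter U \<le> 1/2" for U
  proof -
    \<comment> \<open>For \<open>s = 0\<close> every nonempty set has gauge 1. For
      \<open>s > 0\<close> a one-point set has gauge 0, so it must be shown to encode a null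
      set.\<close>
    consider "U = {}" | "U \<noteq> {}" "s = 0" | "U \<noteq> {}" "s > 0" "diameter U = 0"
      | "U \<noteq> {}" "s > 0" "diameter U > 0"
      using s(1) diameter_ge_0[OF U(1)] by fastforce
    then show ?thesis
    proof cases
      case 1
      then show ?thesis by (intro bexI[of _ "{}"]) (auto simp: V_def)
    next
      case 2
      have "emeasure coin_space (space coin_space) \<le> ennreal C"
        using coin.emeasure_space_1 by (simp add: C_def flip: ennreal_1)
      then show ?thesis using 2
        by (intro bexI[of _ "space coin_space"]) (auto simp: hausdorff_gauge_def, simp add: space_coin_space)
    next
      case 3
      then obtain \<epsilon>0 where \<epsilon>0: "\<epsilon>0 \<in> U" by auto
      have U_eq: "\<epsilon> = \<epsilon>0" if "\<epsilon> \<in> U" for \<epsilon>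
        using diameter_bounded_bound[OF U(1) that \<epsilon>0] 3 by simp
      define W where "W = {p. \<forall>n\<in>{n. n mod m \<notin> Q}. p n = D \<epsilon>0 n}"
      have W: "W \<in> sets coin_space" unfolding W_def by (rule sets_coin_cylinder)
      \<comment> \<open>Since \<open>card Q < m\<close>, a single sign sequence fixes at least one
        bit in every block.\<close>
      have "measure coin_space W \<le> (1/2) ^ K" for K
      proof -
        have "measure coin_space W \<le> measure coin_space {p. \<forall>n\<in>J K. p n = D \<epsilon>0 n}"
          by (intro coin.finite_measure_mono sets_coin_cylinder) (auto simp: W_def J_def)
        also have "\<dots> \<le> (1/2) ^ K"
          unfolding cyl_prob using Q(3) by (intro power_decreasing) auto
        finally show ?thesis .
      qed
      then have "measure coin_space W \<le> 0"
        by (intro LIMSEQ_le_const[OF LIMSEQ_power_zero[of "1/2::real"]]) auto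
      then have "emeasure coin_space W = 0"
        by (simp add: coin.emeasure_eq_measure measure_le_0_iff)
      moreover have "V U \<subseteq> W" using U_eq by (auto simp: V_def W_def)
      ultimately show ?thesis using W by (intro bexI[of _ W]) auto
    next
      case 4
      define \<delta> where "\<delta> = diameter U"
      have \<delta>: "0 < \<delta>" "\<delta> \<le> 1/2" using 4 U by (simp_all add: \<delta>_def)
      obtain \<epsilon>0 where \<epsilon>0: "\<epsilon>0 \<in> U" using 4 by auto
      \<comment> \<open>This brackets \<open>\<delta>\<close> between \<open>(1/2) ^ Suc N\<close>
        and \<open>(1/2) ^ N\<close>: the members of \<open>U\<close> share their first
        \<open>N\<close> signs, which contain \<open>K\<close> complete blocks.\<close>
      define k where "k = (LEAST k. (1/2) ^ k \<le> \<delta>)"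
      obtain k0 where "(1/2) ^ k0 < \<delta>" using real_arch_pow_inv[OF \<delta>(1), of "1/2"] by auto
      then have k: "(1/2) ^ k \<le> \<delta>" unfolding k_def by (intro LeastI[of "\<lambda>k. (1/2) ^ k \<le> \<delta>" k0] less_imp_le)
      then have "k \<noteq> 0" using \<delta> by (intro notI) auto
      then obtain N where N: "k = Suc N" by (cases k) auto
      have \<delta>N: "\<delta> < (1/2) ^ N"
        using not_less_Least[of N "\<lambda>k. (1/2) ^ k \<le> \<delta>"] N by (simp add: k_def not_le)
      define K where "K = N div m"
      define W where "W = {p. \<forall>n\<in>J K. p n = D \<epsilon>0 n}"
      have "V U \<subseteq> W"
        unfolding W_def
      proof (rule V_cyl)
        fix \<epsilon> n assume "\<epsilon> \<in> U" "1 \<le> n" "n \<le> m * K"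
        moreover have "dist \<epsilon> \<epsilon>0 < (1/2) ^ N"
          using diameter_bounded_bound[OF U(1) \<open>\<epsilon> \<in> U\<close> \<epsilon>0] \<delta>N by (simp add: \<delta>_def)
        moreover have "m * K \<le> N" by (simp add: K_def)
        ultimately show "sign_at \<epsilon> n = sign_at \<epsilon>0 n"
          by (intro dist_sign_seq_lt_imp_eq[of \<epsilon> \<epsilon>0 N]) auto
      qed
      moreover have "emeasure coin_space W \<le> ennreal C * hausdorff_gauge s U"
      proof -
        have cQ: "card Q \<le> m" using Q(3) by simp
        \<comment> \<open>Each block has at least \<open>s * m\<close> free bits, so
          \<open>K\<close> blocks give the exponent \<open>Suc N * s\<close> up to a loss of at most
          \<open>m\<close> from the incomplete block; the constant \<open>C = 2 ^ m\<close> absorbs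
          this loss.\<close>
        have "N = m * K + N mod m" by (simp add: K_def)
        then have "Suc N \<le> m * K + m" using mod_less_divisor[OF \<open>m > 0\<close>, of N] by linarith
        then have "real (Suc N) * s \<le> (real m * real K + real m) * s"
          using s(1) by (intro mult_right_mono) (simp_all flip: of_nat_mult of_nat_add)
        also have "\<dots> = (real K + 1) * (s * m)" by (simp add: algebra_simps)
        also have "\<dots> \<le> (real K + 1) * (m - card Q)" using s(2) by (intro mult_left_mono) auto
        also have "\<dots> \<le> real (K * (m - card Q)) + m"
          using cQ by (simp add: algebra_simps of_nat_diff)
        finally have exp: "real (Suc N) * s \<le> real (K * (m - card Q)) + m" .
        have "(1/2::real) ^ (K * (m - card Q)) = 2 powr - real (K * (m - card Q))"
          by (simp only: powr_minus powr_realpow zero_less_numeral power_one_over inverse_eq_divide)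
        also have "\<dots> \<le> 2 powr (real m + - (real (Suc N) * s))"
          using exp by (intro powr_mono) auto
        also have "\<dots> = C * 2 powr - (real (Suc N) * s)"
          by (simp only: C_def powr_add powr_realpow zero_less_numeral)
        also have "2 powr - (real (Suc N) * s) = ((1/2) ^ k) powr s"
          unfolding N power_one_over
          by (simp add: powr_realpow[symmetric] powr_powr powr_minus[symmetric] inverse_eq_divide[symmetric] powr_divide del: of_nat_Suc power_Suc)
        also have "C * \<dots> \<le> C * \<delta> powr s"
          using k 4(2) by (intro mult_left_mono powr_mono2) (auto simp: C_def)
        finally have "measure coin_space W \<le> C * \<delta> powr s"
          by (simp add: W_def cyl_prob)
        then show ?thesis
          using 4 by (simp add: coin.emeasure_eq_measure hausdorff_gauge_def \<delta>_def C_def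
              flip: ennreal_mult)
      qed
      ultimately show ?thesis
        using sets_coin_cylinder by (intro bexI[of _ W]) (auto simp: W_def)
    qed
  qed
  \<comment> \<open>Every bit sequence is encoded in \<open>E\<close>, so a cover of
    \<open>E\<close> yields sets \<open>W i\<close> covering the whole coin space, of total mass 1.
    One scale suffices, the measure being a supremum over scales.\<close>
  have "1 / ennreal C \<le> hausdorff_premeasure (1/2) s E"
    unfolding hausdorff_premeasure_def
  proof (rule INF_greatest)
    fix U :: "nat \<Rightarrow> sign_seq set"
    assume "U \<in> {U. E \<subseteq> (\<Union>i. U i) \<and> (\<forall>i. bounded (U i) \<and> diameter (U i) \<le> 1/2)}"
    then have U: "E \<subseteq> (\<Union>i. U i)" "\<And>i. bounded (U i)" "\<And>i. diameter (U i) \<le> 1/2" by auto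
    then have "\<exists>W. W \<in> sets coin_space \<and> V (U i) \<subseteq> W \<and>
        emeasure coin_space W \<le> ennreal C * hausdorff_gauge s (U i)" for i
      using gauge[of "U i"] by blast
    then obtain W where W: "\<And>i. W i \<in> sets coin_space" "\<And>i. V (U i) \<subseteq> W i"
      "\<And>i. emeasure coin_space (W i) \<le> ennreal C * hausdorff_gauge s (U i)"
      by metis
    have "UNIV \<subseteq> (\<Union>i. W i)"
    proof
      fix p
      obtain \<epsilon> where "\<epsilon> \<in> E" "\<forall>n. n mod m \<notin> Q \<longrightarrow> D \<epsilon> n = p n"
        using E[of p] unfolding D_def by blast
      moreover from this U(1) obtain i where "\<epsilon> \<in> U i" by blast
      ultimately have "p \<in> V (U i)" by (auto simp: V_def)
      then show "p \<in> (\<Union>i. W i)" using W(2) by blast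
    qed
    then have "1 = emeasure coin_space (\<Union>i. W i)"
      using coin.emeasure_space_1 by (simp add: space_coin_space top_unique)
    also have "\<dots> \<le> (\<Sum>i. emeasure coin_space (W i))"
      using W(1) by (intro emeasure_subadditive_countably) auto
    also have "\<dots> \<le> (\<Sum>i. ennreal C * hausdorff_gauge s (U i))"
      using W(3) by (intro suminf_le) auto
    also have "\<dots> = (\<Sum>i. hausdorff_gauge s (U i)) * ennreal C"
      by (simp add: mult.commute)
    finally show "1 / ennreal C \<le> (\<Sum>i. hausdorff_gauge s (U i))"
      by (intro divide_le_posI_ennreal) (simp_all add: C_def mult.commute)
  qed
  also have "\<dots> \<le> hausdorff_measure s E"
    unfolding hausdorff_measure_def by (intro SUP_upper) auto
  finally show ?thesis
    using ennreal_zero_less_divide[of 1 "ennreal C"] by auto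
qed

section \<open>Prescribed sums of a sequence with Levy vectors\<close>

lemma levy_vector_not_summable:
  assumes "levy_vector a u" "\<gamma> > 0"
  shows "\<not> summable (\<lambda>n. if a (Suc n) /\<^sub>R norm (a (Suc n)) \<in> ball u \<gamma> then norm (a (Suc n)) else 0)"
    (is "\<not> summable ?f")
proof
  assume "summable ?f"
  then have "(\<Sum>n. ennreal (?f n)) \<noteq> \<infinity>"
    by (subst suminf_ennreal2) auto
  moreover have "ennreal (?f n) = ennreal (norm (a (Suc n)) *
      of_bool (a (Suc n) /\<^sub>R norm (a (Suc n)) \<in> ball u \<gamma>))" for n
    by simp
  ultimately show False using assms by (simp add: levy_vector_def)
qed

lemma exists_sign_seq:
  assumes "\<And>n. e n \<in> {-1, 1 :: real}"
  obtains \<epsilon> where "\<And>n. sign_at \<epsilon> (Suc n) = e n"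
proof
  define f where "f = (\<lambda>n\<in>{1::nat..}. e (n - 1))"
  have "f \<in> {1..} \<rightarrow>\<^sub>E {-1, 1}" unfolding f_def using assms by (intro restrict_PiE_iff[THEN iffD2]) simp
  then show "sign_at (Abs_sign_seq f) (Suc n) = e n" for n
    by (simp add: Abs_sign_seq_inverse) (simp add: f_def)
qed

theorem theorem1p5:
  fixes a :: "nat \<Rightarrow> real ^ 'd" and L :: "real ^ 'd"
  assumes "(\<lambda>n. norm (a n)) \<longlonglongrightarrow> 0"
    and "\<exists>V. card V = CARD('d) \<and> independent V \<and> (\<forall>u\<in>V. levy_vector a u)"
  shows "hausdorff_dim
     {\<epsilon> :: sign_seq. (\<lambda>N. \<Sum>n=1..N. sign_at \<epsilon> n *\<^sub>R a n) \<longlonglongrightarrow> L} = 1"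
proof (rule antisym[OF hausdorff_dim_sign_seq_le_1])
  define E where "E = {\<epsilon> :: sign_seq. (\<lambda>N. \<Sum>n=1..N. sign_at \<epsilon> n *\<^sub>R a n) \<longlonglongrightarrow> L}"
  define b where "b n = a (Suc n)" for n
  define d where "d = CARD('d)"
  obtain B where B: "card B = d" "independent B" "\<And>u. u \<in> B \<Longrightarrow> levy_vector a u"
    using assms(2) by (auto simp: d_def)
  have "a \<longlonglongrightarrow> 0" using assms(1) by (rule tendsto_norm_zero_cancel)
  then have b: "b \<longlonglongrightarrow> 0" unfolding b_def by (rule LIMSEQ_Suc)
  have levy: "\<not> summable (\<lambda>n. if b n /\<^sub>R norm (b n) \<in> ball u \<gamma> then norm (b n) else 0)"
    if "u \<in> B" "\<gamma> > 0" for u \<gamma>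
    unfolding b_def using B(3)[OF that(1)] that(2) by (rule levy_vector_not_summable)
  \<comment> \<open>The dimension is an infimum over exponents of measure zero, so it suffices to
    exclude every \<open>s < 1\<close>.\<close>
  have pos: "hausdorff_measure s E \<noteq> 0" if s: "0 \<le> s" "s < 1" for s
  proof -
    \<comment> \<open>This gives \<open>s < 1 - (d + 1) / m\<close>: even with \<open>d + 1\<close>
      residues lost, the free ones make up at least the fraction \<open>s\<close> of each
      block.\<close>
    obtain m :: nat where m: "(d + 1) / (1 - s) < m" using reals_Archimedean2 by blast
    then have "real d + 1 < m * (1 - s)" using s by (simp add: divide_less_eq)
    moreover have "m * (1 - s) \<le> m" using s by (simp add: algebra_simps)
    ultimately have "m > d + 1" "s * m \<le> real m - (d + 1)" by (simp_all add: algebra_simps)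
    obtain Q q where Q: "Q \<subseteq> {..<m}" "q \<in> Q" "card Q \<le> d + 1"
      and pat: "\<And>L p. (\<And>n. p n \<in> {-1, 1 :: real}) \<Longrightarrow> \<exists>\<epsilon>. (\<forall>n. \<epsilon> n \<in> {-1, 1}) \<and>
        (\<lambda>n. \<epsilon> n *\<^sub>R b n) sums L \<and> (\<forall>n. n mod m \<notin> Q \<longrightarrow> \<epsilon> n * \<epsilon> (m * (n div m) + q) = p n)"
      using signed_sums_with_pattern[OF b B(2) _ levy, of m] B(1) \<open>m > d + 1\<close>
      by (simp add: d_def) blast
    show ?thesis
    proof (rule hausdorff_measure_sign_seq_pos[OF Q(1,2)])
      show "card Q < m" using Q(3) \<open>m > d + 1\<close> by simp
      then show "s * m \<le> m - card Q"
        using \<open>s * m \<le> real m - (d + 1)\<close> Q(3) by (simp add: of_nat_diff)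
      show "0 \<le> s" by (rule s)
      fix P :: "nat \<Rightarrow> bool"
      have "\<exists>e. (\<forall>n. e n \<in> {-1, 1 :: real}) \<and> (\<lambda>n. e n *\<^sub>R b n) sums L \<and>
          (\<forall>n. n mod m \<notin> Q \<longrightarrow> e n * e (m * (n div m) + q) = (if P n then 1 else -1))"
        by (rule pat) simp
      then obtain e where e: "\<And>n. e n \<in> {-1, 1 :: real}" "(\<lambda>n. e n *\<^sub>R b n) sums L"
        "\<And>n. n mod m \<notin> Q \<Longrightarrow> e n * e (m * (n div m) + q) = (if P n then 1 else -1)"
        by blast
      obtain \<epsilon> where \<epsilon>: "\<And>n. sign_at \<epsilon> (Suc n) = e n"
        using exists_sign_seq[of e] e(1) by blast
      have "(\<lambda>N. \<Sum>n=1..N. sign_at \<epsilon> n *\<^sub>R a n) \<longlonglongrightarrow> L"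
        using e(2) unfolding sums_def b_def
        by (simp add: sum.atLeast1_atMost_eq \<epsilon>)
      then have "\<epsilon> \<in> E" by (simp add: E_def)
      then show "\<exists>\<epsilon>\<in>E. \<forall>n. n mod m \<notin> Q \<longrightarrow>
          (sign_at \<epsilon> (Suc n) * sign_at \<epsilon> (Suc (m * (n div m) + q)) = 1) = P n"
        by (intro bexI[of _ \<epsilon>]) (auto simp: \<epsilon> e(3))
    qed
  qed
  show "1 \<le> hausdorff_dim {\<epsilon>. (\<lambda>N. \<Sum>n=1..N. sign_at \<epsilon> n *\<^sub>R a n) \<longlonglongrightarrow> L}"
    unfolding E_def[symmetric] hausdorff_dim_def
  proof (rule INF_greatest)
    fix s assume "s \<in> {s. 0 \<le> s \<and> hausdorff_measure s E = 0}"
    then have "1 \<le> s" using pos by force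
    then show "1 \<le> ennreal s" using ennreal_leI[of 1 s] by simp
  qed
qed

end
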